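(* Let $\mu$ be a computable probability measure on $\{0,1\}^{\mathbb{N}}$, let $T:\{0,1\}^{\mathbb{N}}\to\{0,1\}^{\mathbb{N}}$ be a $\mu$-a.e. computable map, and let $Y\in\{0,1\}^{\mathbb{N}}$ be $\mu_T$-computably random. Then $Y=T(X)$ for some $\mu$-computably random $X\in\{0,1\}^{\mathbb{N}}$.
   Context: A partial map $T$ is $\mu$-a.e. computable if it is partial computable and $\mu(\mathrm{dom}\,T)=1$. $\mu_T(A)=\mu(T^{-1}(A))$ is the push-forward measure. For a computable measure $\nu$ on $\{0,1\}^{\mathbb{N}}$, $Z$ is $\nu$-computably random iff $t(Z)<\infty$ for every lower semicomputable $t:\{0,1\}^{\mathbb{N}}\to[0,\infty]$ and every computable measure $\kappa$ with $\int_{[\sigma]}t\,d\nu\le\kappa([\sigma])$ for all strings $\sigma$ (equivalently, no computable $\nu$-martingale succeeds on $Z$). *)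

theory Defs
  imports "HOL-Probability.Probability" "HOL-Library.Nat_Bijection" "HOL-Library.Sublist"
begin

definition prim_rec_op :: "(nat list \<Rightarrow> nat) \<Rightarrow> (nat list \<Rightarrow> nat) \<Rightarrow> nat list \<Rightarrow> nat" where
  "prim_rec_op g h xs = (case xs of [] \<Rightarrow> 0
     | k # ys \<Rightarrow> rec_nat (g ys) (\<lambda>j r. h (j # r # ys)) k)"

text \<open>recfn n f: f is a total recursive function of arity n (arguments given as a list).
  Minimisation is only applied to regular functions, so all members are total.\<close>
inductive recfn :: "nat \<Rightarrow> (nat list \<Rightarrow> nat) \<Rightarrow> bool" where
  zero: "recfn n (\<lambda>_. 0)"
| succ: "recfn 1 (\<lambda>xs. Suc (hd xs))"
| proj: "i < n \<Longrightarrow> recfn n (\<lambda>xs. xs ! i)"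
| comp: "recfn m f \<Longrightarrow> length gs = m \<Longrightarrow> (\<forall>g\<in>set gs. recfn n g)
          \<Longrightarrow> recfn n (\<lambda>xs. f (map (\<lambda>g. g xs) gs))"
| prim: "recfn n g \<Longrightarrow> recfn (Suc (Suc n)) h \<Longrightarrow> recfn (Suc n) (prim_rec_op g h)"
| mini: "recfn (Suc n) f \<Longrightarrow> (\<forall>xs. \<exists>y. f (y # xs) = 0)
          \<Longrightarrow> recfn n (\<lambda>xs. LEAST y. f (y # xs) = 0)"

definition computable :: "(nat \<Rightarrow> nat) \<Rightarrow> bool" where
  "computable f \<longleftrightarrow> (\<exists>g. recfn 1 g \<and> (\<forall>x. f x = g [x]))"

definition bl_code :: "bool list \<Rightarrow> nat" where
  "bl_code \<sigma> = list_encode (map of_bool \<sigma>)"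

definition bl_decode :: "nat \<Rightarrow> bool list" where
  "bl_decode n = map (\<lambda>k. k \<noteq> 0) (list_decode n)"

definition rat_decode :: "nat \<Rightarrow> real" where
  "rat_decode n = (case prod_decode n of (a, b) \<Rightarrow> (case prod_decode b of (p, q) \<Rightarrow>
       (if even a then 1 else -1) * real p / real (Suc q)))"

definition cantor :: "(nat \<Rightarrow> bool) measure" where
  "cantor = PiM UNIV (\<lambda>_::nat. count_space (UNIV::bool set))"

definition pre :: "(nat \<Rightarrow> bool) \<Rightarrow> nat \<Rightarrow> bool list" where
  "pre X n = map X [0..<n]"

definition cyl :: "bool list \<Rightarrow> (nat \<Rightarrow> bool) set" where
  "cyl \<sigma> = {X. pre X (length \<sigma>) = \<sigma>}"

definition computable_measure :: "(nat \<Rightarrow> bool) measure \<Rightarrow> bool" where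
  "computable_measure M \<longleftrightarrow> sets M = sets cantor \<and> finite_measure M \<and>
     (\<exists>f. computable f \<and> (\<forall>\<sigma> n.
        \<bar>rat_decode (f (prod_encode (bl_code \<sigma>, n))) - measure M (cyl \<sigma>)\<bar> \<le> (1/2) ^ n))"

definition lower_semicomputable :: "((nat \<Rightarrow> bool) \<Rightarrow> ennreal) \<Rightarrow> bool" where
  "lower_semicomputable t \<longleftrightarrow> (\<exists>f. computable f \<and> (\<forall>X.
     t X = (SUP n. (case prod_decode (f n) of (s, r) \<Rightarrow>
              (if X \<in> cyl (bl_decode s) then ennreal (rat_decode r) else 0)))))"

definition computably_random :: "(nat \<Rightarrow> bool) measure \<Rightarrow> (nat \<Rightarrow> bool) \<Rightarrow> bool" where
  "computably_random \<nu> Z \<longleftrightarrow> (\<forall>t \<kappa>. lower_semicomputable t \<longrightarrow> computable_measure \<kappa> \<longrightarrow>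
     (\<forall>\<sigma>. set_nn_integral \<nu> (cyl \<sigma>) t \<le> emeasure \<kappa> (cyl \<sigma>)) \<longrightarrow> t Z < \<infinity>)"

definition partial_computable :: "((nat \<Rightarrow> bool) \<Rightarrow> (nat \<Rightarrow> bool) option) \<Rightarrow> bool" where
  "partial_computable T \<longleftrightarrow> (\<exists>\<phi> f. computable f \<and> (\<forall>\<sigma>. f (bl_code \<sigma>) = bl_code (\<phi> \<sigma>)) \<and>
     (\<forall>\<sigma> \<tau>. prefix \<sigma> \<tau> \<longrightarrow> prefix (\<phi> \<sigma>) (\<phi> \<tau>)) \<and>
     (\<forall>X Y. T X = Some Y \<longleftrightarrow> (\<forall>n. \<exists>m. prefix (pre Y n) (\<phi> (pre X m)))))"

definition ae_computable :: "(nat \<Rightarrow> bool) measure \<Rightarrow> ((nat \<Rightarrow> bool) \<Rightarrow> (nat \<Rightarrow> bool) option) \<Rightarrow> bool" where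
  "ae_computable \<mu> T \<longleftrightarrow> partial_computable T \<and> measure \<mu> {X. T X \<noteq> None} = 1"

text \<open>Push-forward mu_T(A) = mu(T^-1(A)); off the (full-measure) domain T is
  replaced by an arbitrary constant, which does not affect the measure.\<close>
definition pushforward :: "(nat \<Rightarrow> bool) measure \<Rightarrow> ((nat \<Rightarrow> bool) \<Rightarrow> (nat \<Rightarrow> bool) option) \<Rightarrow> (nat \<Rightarrow> bool) measure" where
  "pushforward \<mu> T = distr \<mu> cantor (\<lambda>X. case T X of Some Y \<Rightarrow> Y | None \<Rightarrow> (\<lambda>_. False))"

end

(* Write nu for the push-forward of mu, and Y|n for the first n bits of Y. The set of X on which T is
   slow at stage n can be made to have measure at most 8^-n; let E_n be that set, and let T_k read T
   with the patience that suffices when X lies in no E_i, i >= k. A mu-test t bounded by kappa, cut off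
   at the first i >= k with X in E_i, is at most t where no such i exists (there T_k = T), and at most
   u = sum_n n 1_{E_n} elsewhere, so its integral over T^-1[sigma] is at most K[sigma] for the computable
   measure K that is the sum of the images of kappa under T_k and of u mu under T.
   Since Y is nu-random, a martingale with savings shows that any computable measure K satisfies
   K[Y|n] <= C nu[Y|n] for all n. Hence a weighted sum G of u and of the countably many cut-off tests
   has bounded mean over T^-1[Y|n], uniformly in n. Choose X_n in T^-1[Y|n] with G(X_n) bounded. At a
   limit point X, lower semicontinuity makes u(X) finite, so that T(X) = Y, and every test finite. *)

theory Submission
  imports Defs
begin

subsection \<open>Closure properties of the recursive functions\<close>

text \<open>The obstacle: a test t for \<mu> is controlled by \<kappa> on cylinders only, and
  \<kappa> may charge the \<mu>-null set where T is undefined, so \<kappa>(T^-1[\<sigma>]) need not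
  be computable. A total T_k has clopen preimages of cylinders, to which the bound carries over, but
  it may be wrong on the sets E_i. There only u is left as a bound, which is why a cut-off test
  rises no faster than the stage: before stage i it is at most i, and u is at least i on E_i. The
  rate 8^-n gives n 8^-n <= 4^-n, so that u has a rapidly convergent mean, and it also beats the
  bound 4^A for the sum of the first A weights of u. Savings are needed because the supremum of
  K[Z|n] / \<nu>[Z|n] need not have integrals bounded by a computable measure; a non-decreasing
  lower bound of the capital does, by monotone convergence. As computable randomness has no
  universal test, all tests are handled at once; the constants C, and hence the weights in G, are
  not effective, which is harmless since G enters only through its mean and through
  compactness.\<close>

definition computable2 :: "(nat \<Rightarrow> nat \<Rightarrow> nat) \<Rightarrow> bool" where
  "computable2 h \<longleftrightarrow> (\<exists>g. recfn 2 g \<and> (\<forall>x y. h x y = g [x, y]))"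

lemma computable2I: "recfn 2 g \<Longrightarrow> (\<And>x y. h x y = g [x, y]) \<Longrightarrow> computable2 h"
  by (auto simp: computable2_def)

lemma computableI: "recfn 1 g \<Longrightarrow> (\<And>x. h x = g [x]) \<Longrightarrow> computable h"
  by (auto simp: computable_def)

lemma recfn_comp1:
  assumes "recfn 1 f" "recfn n g" shows "recfn n (\<lambda>xs. f [g xs])"
  using recfn.comp[of 1 f "[g]" n] assms by simp

lemma recfn_comp2:
  assumes "recfn 2 f" "recfn n g" "recfn n h" shows "recfn n (\<lambda>xs. f [g xs, h xs])"
  using recfn.comp[of 2 f "[g, h]" n] assms by simp

lemma computable_id [simp, intro]: "computable (\<lambda>x. x)"
  by (rule computableI[OF recfn.proj[of 0 1]]) auto

lemma computable_Suc_comp: "computable f \<Longrightarrow> computable (\<lambda>x. Suc (f x))"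
  unfolding computable_def using recfn_comp1[OF recfn.succ] by fastforce

lemma computable_comp: "computable f \<Longrightarrow> computable g \<Longrightarrow> computable (\<lambda>x. f (g x))"
  unfolding computable_def using recfn_comp1 by fastforce

lemma computable_const [simp, intro]: "computable (\<lambda>x. c)"
proof (induction c)
  case 0
  show ?case by (rule computableI[OF recfn.zero]) auto
next
  case (Suc c)
  then show ?case by (rule computable_Suc_comp)
qed

lemma computable2_comp:
  "computable2 h \<Longrightarrow> computable f \<Longrightarrow> computable g \<Longrightarrow> computable (\<lambda>x. h (f x) (g x))"
  unfolding computable_def computable2_def using recfn_comp2 by fastforce

lemma computable2_comp2:
  "computable2 h \<Longrightarrow> computable2 f \<Longrightarrow> computable2 g \<Longrightarrow> computable2 (\<lambda>x y. h (f x y) (g x y))"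
  unfolding computable2_def using recfn_comp2 by fastforce

lemma computable2_comp1:
  "computable f \<Longrightarrow> computable2 g \<Longrightarrow> computable2 (\<lambda>x y. f (g x y))"
  unfolding computable_def computable2_def using recfn_comp1 by fastforce

lemma computable2_fst [simp, intro]: "computable2 (\<lambda>x y. x)"
  by (rule computable2I[OF recfn.proj[of 0 2]]) auto

lemma computable2_snd [simp, intro]: "computable2 (\<lambda>x y. y)"
  by (rule computable2I[OF recfn.proj[of 1 2]]) auto

lemma computable2_const [simp, intro]: "computable2 (\<lambda>x y. c)"
  using computable2_comp1[OF computable_const[of c] computable2_fst] .

lemma computable2_prim3:
  assumes g: "computable g" and h: "recfn 3 h"
  shows "computable2 (\<lambda>k x. rec_nat (g x) (\<lambda>j r. h [j, r, x]) k)"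
proof -
  obtain g' where g': "recfn 1 g'" "\<And>x. g x = g' [x]" using g by (auto simp: computable_def)
  have "recfn (Suc 1) (prim_rec_op g' h)"
    by (rule recfn.prim) (use g' h in \<open>simp_all add: numeral_3_eq_3\<close>)
  then have "recfn 2 (prim_rec_op g' h)" by (simp add: numeral_2_eq_2)
  then show ?thesis
    by (rule computable2I) (simp add: prim_rec_op_def g')
qed

text \<open>The step function of a primitive recursion receives index, accumulator and parameter;
  this pads a binary function to three arguments by selecting the two it reads.\<close>

lemma recfn3_from2:
  assumes "computable2 h" "i < 3" "j < 3"
  shows "\<exists>g. recfn 3 g \<and> (\<forall>xs. g xs = h (xs ! i) (xs ! j))"
proof -
  obtain h' where h': "recfn 2 h'" "\<And>x y. h x y = h' [x, y]"
    using assms(1) by (auto simp: computable2_def)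
  show ?thesis
    using recfn_comp2[OF h'(1) recfn.proj[OF assms(2)] recfn.proj[OF assms(3)]] h'(2) by fastforce
qed

lemma computable2_prim_acc:
  assumes g: "computable g" and h: "computable2 h"
  shows "computable2 (\<lambda>k x. rec_nat (g x) (\<lambda>j r. h r x) k)"
proof -
  obtain h' where h': "recfn 3 h'" "\<And>xs. h' xs = h (xs ! 1) (xs ! 2)"
    using recfn3_from2[OF h, of 1 2] by auto
  show ?thesis using computable2_prim3[OF g h'(1)] h'(2) by simp
qed

lemma computable2_prim_index:
  assumes g: "computable g" and h: "computable2 h"
  shows "computable2 (\<lambda>k x. rec_nat (g x) (\<lambda>j r. h j r) k)"
proof -
  obtain h' where h': "recfn 3 h'" "\<And>xs. h' xs = h (xs ! 0) (xs ! 1)"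
    using recfn3_from2[OF h, of 0 1] by auto
  show ?thesis using computable2_prim3[OF g h'(1)] h'(2) by simp
qed

lemma computable2_swap: "computable2 h \<Longrightarrow> computable2 (\<lambda>x y. h y x)"
  by (rule computable2_comp2[OF _ computable2_snd computable2_fst])

lemma computable2_add: "computable2 (+)"
proof -
  have "rec_nat x (\<lambda>j r. Suc r) k = k + x" for k x :: nat by (induction k) auto
  then show ?thesis
    using computable2_prim_acc[OF computable_id computable2_comp1[OF computable_Suc_comp[OF computable_id] computable2_fst]]
    by simp
qed

lemma computable2_mult: "computable2 (*)"
proof -
  have "rec_nat 0 (\<lambda>j r. r + x) k = k * x" for k x :: nat by (induction k) auto
  then show ?thesis
    using computable2_prim_acc[OF computable_const[of 0] computable2_add] by simp
qed

lemma computable_pred: "computable (\<lambda>x. x - Suc 0)"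
proof -
  have "rec_nat 0 (\<lambda>j r. j) k = k - Suc 0" for k :: nat by (cases k) auto
  then have "computable2 (\<lambda>k x. k - Suc 0)"
    using computable2_prim_index[OF computable_const[of 0] computable2_fst] by simp
  then show ?thesis using computable2_comp[OF _ computable_id computable_id] by fastforce
qed

lemma computable2_sub: "computable2 (-)"
proof -
  have "rec_nat x (\<lambda>j r. r - Suc 0) k = x - k" for k x :: nat by (induction k) auto
  then have "computable2 (\<lambda>k x. x - k)"
    using computable2_prim_acc[OF computable_id computable2_comp1[OF computable_pred computable2_fst]] by simp
  then show ?thesis by (rule computable2_swap)
qed

lemma computable_triangle: "computable triangle"
proof -
  have "rec_nat 0 (\<lambda>j r. Suc j + r) k = triangle k" for k by (induction k) auto
  then have "computable2 (\<lambda>k x. triangle k)"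
    using computable2_prim_index[OF computable_const[of 0]
        computable2_comp2[OF computable2_add computable2_comp1[OF computable_Suc_comp[OF computable_id] computable2_fst] computable2_snd]]
    by simp
  then show ?thesis using computable2_comp[OF _ computable_id computable_id] by fastforce
qed

lemma computable2_prod_encode: "computable2 (\<lambda>x y. prod_encode (x, y))"
  unfolding prod_encode_def prod.case
  by (intro computable2_comp2[OF computable2_add] computable2_comp1[OF computable_triangle] computable2_add
      computable2_fst)

lemma computable_mini:
  assumes f: "computable2 f" and ex: "\<And>x. \<exists>y. f y x = 0"
  shows "computable (\<lambda>x. LEAST y. f y x = 0)"
proof -
  obtain g where g: "recfn 2 g" "\<And>x y. f x y = g [x, y]" using f by (auto simp: computable2_def)
  have "recfn (Suc 1) (\<lambda>xs. g [xs ! 0, xs ! 1])"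
    using recfn_comp2[OF g(1) recfn.proj[of 0 2] recfn.proj[of 1 2]] by (simp add: numeral_2_eq_2)
  then have "recfn 1 (\<lambda>xs. LEAST y. (\<lambda>xs. g [xs ! 0, xs ! 1]) (y # xs) = 0)"
    by (rule recfn.mini) (use ex g(2) in auto)
  then show ?thesis by (rule computableI) (simp add: g(2))
qed

section \<open>Pairing and its inverses\<close>

abbreviation pair :: "nat \<Rightarrow> nat \<Rightarrow> nat" where "pair x y \<equiv> prod_encode (x, y)"
definition pfst :: "nat \<Rightarrow> nat" where "pfst z = fst (prod_decode z)"
definition psnd :: "nat \<Rightarrow> nat" where "psnd z = snd (prod_decode z)"

lemma pfst_pair [simp]: "pfst (pair x y) = x" and psnd_pair [simp]: "psnd (pair x y) = y"
  by (simp_all add: pfst_def psnd_def)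

lemma pair_pfst_psnd [simp]: "pair (pfst z) (psnd z) = z"
  by (simp add: pfst_def psnd_def)

lemma pfst_0 [simp]: "pfst 0 = 0" and psnd_0 [simp]: "psnd 0 = 0"
  using pfst_pair[of 0 0] psnd_pair[of 0 0] by (simp_all add: prod_encode_def)

text \<open>With x and y the components, z = \<open>triangle (x + y) + x\<close>, so x + y is the
  largest k with \<open>triangle k \<le> z\<close>. Finding it by search makes decoding accessible
  to minimisation.\<close>

lemma prod_decode_Least:
  defines "k \<equiv> (\<lambda>z. LEAST k. Suc z - triangle (Suc k) = 0)"
  shows "pfst z = z - triangle (k z)" "psnd z = k z - (z - triangle (k z))"
proof -
  define x y where "x = pfst z" and "y = psnd z"
  have z: "z = triangle (x + y) + x" using pair_pfst_psnd[of z] by (simp add: x_def y_def prod_encode_def)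
  have mono: "triangle a \<le> triangle b" if "a \<le> b" for a b
    using that by (induction rule: dec_induct) auto
  have "k z = x + y"
    unfolding k_def
  proof (rule Least_equality)
    show "Suc z - triangle (Suc (x + y)) = 0" using z by simp
    fix j assume "Suc z - triangle (Suc j) = 0"
    then have "z < triangle (Suc j)" by simp
    then show "x + y \<le> j" using mono[of "Suc j" "x + y"] z by linarith
  qed
  moreover have "z - triangle (x + y) = x" using z by linarith
  ultimately show "pfst z = z - triangle (k z)" "psnd z = k z - (z - triangle (k z))"
    by (simp_all add: x_def y_def)
qed

lemma computable_prod_decode: "computable pfst" "computable psnd"
proof -
  let ?k = "\<lambda>z. LEAST k. Suc z - triangle (Suc k) = 0"
  have k: "computable ?k"
  proof (rule computable_mini)
    show "computable2 (\<lambda>y x. Suc x - triangle (Suc y))"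
      by (intro computable2_comp2[OF computable2_sub] computable2_comp1[OF computable_triangle] computable2_snd
         computable2_fst computable2_comp1[OF computable_Suc_comp[OF computable_id]])
    show "\<exists>y. Suc x - triangle (Suc y) = 0" for x by (rule exI[of _ x]) simp
  qed
  have f: "computable (\<lambda>z. z - triangle (?k z))"
    by (intro computable2_comp[OF computable2_sub] computable_comp[OF computable_triangle] k computable_id)
  have s: "computable (\<lambda>z. ?k z - (z - triangle (?k z)))"
    by (intro computable2_comp[OF computable2_sub] k f)
  show "computable pfst" "computable psnd"
    using f s by (simp_all add: prod_decode_Least[abs_def])
qed

section \<open>Closure rules for computable functions and decidable predicates\<close>

named_theorems cintro

lemmas [cintro] = computable_id computable_const computable_Suc_comp
  computable2_comp[OF computable2_add] computable2_comp[OF computable2_sub]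
  computable2_comp[OF computable2_mult] computable2_comp[OF computable2_prod_encode]
  computable_comp[OF computable_prod_decode(1)] computable_comp[OF computable_prod_decode(2)]

text \<open>Joint computability of a binary function is expressed through a single code of the two
  arguments. The rules below can then be stated for \<open>computable\<close> alone, with premises
  of the form \<open>computable (\<lambda>z. b (pfst z) (psnd z))\<close>.\<close>

lemma computable_reparam:
  assumes "computable (\<lambda>z. b (pfst z) (psnd z))"
  shows "computable2 b"
proof -
  have "computable2 (\<lambda>x y. (\<lambda>z. b (pfst z) (psnd z)) (pair x y))"
    by (rule computable2_comp1[OF assms computable2_prod_encode])
  then show ?thesis by simp
qed

lemma computable_comp_pair:
  assumes "computable (\<lambda>z. b (pfst z) (psnd z))" "computable f" "computable g"
  shows "computable (\<lambda>x. b (f x) (g x))"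
  using computable2_comp[OF computable_reparam] assms by blast

text \<open>Here the step may use the parameter x as well as index and accumulator; the three are
  packed into one code before the unary witness \<open>H\<close> is applied.\<close>

lemma computable_rec_nat [cintro]:
  assumes g: "computable g" and h: "computable (\<lambda>z. h (pfst z) (pfst (psnd z)) (psnd (psnd z)))"
    and n: "computable n"
  shows "computable (\<lambda>x. rec_nat (g x) (\<lambda>j r. h x j r) (n x))"
proof -
  let ?H = "\<lambda>z. h (pfst z) (pfst (psnd z)) (psnd (psnd z))"
  obtain H where H: "recfn 1 H" "\<And>z. ?H z = H [z]" using h by (auto simp: computable_def)
  obtain P where P: "recfn 2 P" "\<And>x y. pair x y = P [x, y]"
    using computable2_prod_encode by (auto simp: computable2_def)
  have p: "recfn 3 (\<lambda>xs. xs ! i)" if "i < 3" for i using recfn.proj that by blast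
  have "recfn 3 (\<lambda>xs. H [P [xs ! 2, P [xs ! 0, xs ! 1]]])"
    by (intro recfn_comp1[OF H(1)] recfn_comp2[OF P(1)] p) auto
  from computable2_prim3[OF g this]
  have "computable2 (\<lambda>k x. rec_nat (g x) (\<lambda>j r. h x j r) k)"
    by (simp flip: H(2) P(2))
  from computable2_comp[OF this n computable_id] show ?thesis .
qed

lemma computable_Least [cintro]:
  assumes P: "computable (\<lambda>z. of_bool (P (pfst z) (psnd z)))" and ex: "\<And>x. \<exists>y. P x y"
  shows "computable (\<lambda>x. LEAST y. P x y)"
proof -
  have "computable2 (\<lambda>x y. 1 - of_bool (P x y) :: nat)"
    by (intro computable2_comp2[OF computable2_sub] computable2_const
        computable_reparam[OF P])
  then have "computable2 (\<lambda>y x. 1 - of_bool (P x y) :: nat)" by (rule computable2_swap)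
  from computable_mini[OF this] ex have "computable (\<lambda>x. LEAST y. 1 - of_bool (P x y) = (0::nat))"
    by simp
  moreover have "(1 - of_bool (P x y) = (0::nat)) = P x y" for x y by simp
  ultimately show ?thesis by (simp only:)
qed

lemma computable_not [cintro]:
  assumes "computable (\<lambda>x. of_bool (P x))" shows "computable (\<lambda>x. of_bool (\<not> P x))"
proof -
  have "computable (\<lambda>x. 1 - of_bool (P x))"
    by (intro cintro assms)
  moreover have "1 - of_bool (P x) = (of_bool (\<not> P x) :: nat)" for x by simp
  ultimately show ?thesis by (simp only:)
qed

lemma computable_conj [cintro]:
  "computable (\<lambda>x. of_bool (P x)) \<Longrightarrow> computable (\<lambda>x. of_bool (Q x)) \<Longrightarrow> computable (\<lambda>x. of_bool (P x \<and> Q x))"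
  using computable2_comp[OF computable2_mult, of "\<lambda>x. of_bool (P x)" "\<lambda>x. of_bool (Q x)"]
  by (simp add: of_bool_conj)

lemma computable_eq_0: "computable f \<Longrightarrow> computable (\<lambda>x. of_bool (f x = 0))"
proof -
  assume f: "computable f"
  have "of_bool (f x = 0) = 1 - f x" for x by auto
  then show ?thesis using computable2_comp[OF computable2_sub computable_const[of 1] f] by simp
qed

lemma computable_le [cintro]: "computable f \<Longrightarrow> computable g \<Longrightarrow> computable (\<lambda>x. of_bool (f x \<le> g x))"
  using computable_eq_0[OF computable2_comp[OF computable2_sub, of f g]] by simp

lemma computable_eq [cintro]: "computable f \<Longrightarrow> computable g \<Longrightarrow> computable (\<lambda>x. of_bool (f x = g x))"
  using computable_conj[OF computable_le[of f g] computable_le[of g f]] by (simp add: order_eq_iff)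

lemma computable_less [cintro]: "computable f \<Longrightarrow> computable g \<Longrightarrow> computable (\<lambda>x. of_bool (f x < g x))"
  using computable_not[OF computable_le[of g f]] by (simp add: not_le)

lemma computable_iff [cintro]:
  "computable (\<lambda>x. of_bool (P x)) \<Longrightarrow> computable (\<lambda>x. of_bool (Q x)) \<Longrightarrow> computable (\<lambda>x. of_bool (P x = Q x))"
proof -
  assume "computable (\<lambda>x. of_bool (P x))" "computable (\<lambda>x. of_bool (Q x))"
  from computable_eq[OF this] show ?thesis by (simp add: of_bool_eq_iff)
qed

lemma computable_if [cintro]:
  assumes "computable (\<lambda>x. of_bool (P x))" "computable f" "computable g"
  shows "computable (\<lambda>x. if P x then f x else g x)"
proof -
  have "computable (\<lambda>x. of_bool (P x) * f x + of_bool (\<not> P x) * g x)"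
    by (intro cintro assms)
  moreover have "(\<lambda>x. of_bool (P x) * f x + of_bool (\<not> P x) * g x) = (\<lambda>x. if P x then f x else g x)"
    by auto
  ultimately show ?thesis by simp
qed

lemma computable_sum [cintro]:
  assumes "computable (\<lambda>z. f (pfst z) (psnd z))" "computable n"
  shows "computable (\<lambda>x. \<Sum>i<n x. f x i)"
proof -
  have "(\<Sum>i<m. f x i) = rec_nat 0 (\<lambda>j r. r + f x j) m" for x m by (induction m) auto
  then show ?thesis
    by (simp, intro cintro assms computable_comp_pair[of f, OF assms(1)])
qed

lemma computable_Ball [cintro]:
  assumes "computable (\<lambda>z. of_bool (P (pfst z) (psnd z)))" "computable n"
  shows "computable (\<lambda>x. of_bool (\<forall>i<n x. P x i))"
proof -
  have "computable (\<lambda>x. of_bool ((\<Sum>i<n x. of_bool (\<not> P x i)) = (0::nat)))"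
    by (intro cintro assms)
  moreover have "((\<Sum>i<n x. of_bool (\<not> P x i)) = (0::nat)) = (\<forall>i<n x. P x i)" for x
    by (subst sum_eq_0_iff) auto
  ultimately show ?thesis by (simp only:)
qed

lemma computable_power [cintro]:
  assumes "computable f" "computable n"
  shows "computable (\<lambda>x. f x ^ n x)"
proof -
  have "f x ^ m = rec_nat 1 (\<lambda>j r. r * f x) m" for x m by (induction m) auto
  then show ?thesis
    by (simp, intro cintro assms computable_comp[of f])
qed

lemma computable_div [cintro]:
  assumes "computable f" "computable g"
  shows "computable (\<lambda>x. f x div g x)"
proof -
  \<comment> \<open>The quotient is the least y with f x < (y + 1) * g x. The disjunct
    \<open>g x = 0\<close> keeps the search total, as minimisation demands.\<close>
  have *: "f x div g x = (if g x = 0 then 0 else LEAST y. f x < Suc y * g x \<or> g x = 0)" for x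
  proof (cases "g x = 0")
    case False
    have "(LEAST y. f x < Suc y * g x \<or> g x = 0) = f x div g x"
    proof (rule Least_equality)
      show "f x < Suc (f x div g x) * g x \<or> g x = 0"
        using False by (metis dividend_less_div_times mult_Suc add.commute neq0_conv)
      fix y assume "f x < Suc y * g x \<or> g x = 0"
      then show "f x div g x \<le> y" using False by (metis less_Suc_eq_le less_mult_imp_div_less)
    qed
    then show ?thesis using False by simp
  qed simp
  \<comment> \<open>The collected rules cover negation and conjunction, so the disjunction is
    rewritten by De Morgan.\<close>
  have d: "(a \<or> b) = (\<not> (\<not> a \<and> \<not> b))" for a b by auto
  have ex: "\<exists>y. f x < Suc y * g x \<or> g x = 0" for x
    by (metis dividend_less_div_times mult_Suc add.commute neq0_conv)
  show ?thesis
    unfolding * d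
    by (intro cintro assms computable_comp[of f] computable_comp[of g] ex[unfolded d])
qed

lemma computable_odd [cintro]:
  assumes "computable f" shows "computable (\<lambda>x. of_bool (odd (f x)))"
proof -
  have "computable (\<lambda>x. f x - 2 * (f x div 2))" by (intro cintro assms)
  moreover have "f x - 2 * (f x div 2) = of_bool (odd (f x))" for x
    by (simp add: minus_mult_div_eq_mod mod2_eq_if)
  ultimately show ?thesis by simp
qed

subsection \<open>Codes of strings\<close>

text \<open>The code of a non-empty list is the successor of the pair of its head and the code of
  its tail, so \<open>psnd (r - 1)\<close> is the code of the tail. As \<open>psnd 0 = 0\<close>,
  the code 0 of the empty list is a fixed point, and dropping past the end is harmless.\<close>

definition code_drop :: "nat \<Rightarrow> nat \<Rightarrow> nat" where
  "code_drop c j = rec_nat c (\<lambda>_ r. psnd (r - 1)) j"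

definition code_bit :: "nat \<Rightarrow> nat \<Rightarrow> bool" where
  "code_bit c j \<longleftrightarrow> pfst (code_drop c j - 1) \<noteq> 0"

definition code_len :: "nat \<Rightarrow> nat" where
  "code_len c = (LEAST n. code_drop c n = 0)"

lemma code_drop_list_encode: "code_drop (list_encode xs) j = list_encode (drop j xs)"
proof (induction j)
  case (Suc j)
  have "code_drop (list_encode xs) (Suc j) = psnd (list_encode (drop j xs) - 1)"
    using Suc by (simp add: code_drop_def)
  also have "\<dots> = list_encode (drop (Suc j) xs)"
    by (cases "drop j xs") (simp_all add: drop_Suc tl_drop[symmetric])
  finally show ?case .
qed (simp add: code_drop_def)

lemma list_encode_eq_0_iff: "list_encode xs = 0 \<longleftrightarrow> xs = []"
  by (cases xs) auto

lemma code_bit_list_encode: "code_bit (list_encode xs) j \<longleftrightarrow> j < length xs \<and> xs ! j \<noteq> 0"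
proof (cases "j < length xs")
  case True
  then have "drop j xs = xs ! j # drop (Suc j) xs" by (simp add: Cons_nth_drop_Suc)
  then show ?thesis using True by (simp add: code_bit_def code_drop_list_encode)
qed (simp add: code_bit_def code_drop_list_encode)

lemma code_len_list_encode: "code_len (list_encode xs) = length xs"
  unfolding code_len_def code_drop_list_encode list_encode_eq_0_iff
  by (rule Least_equality) auto

lemma code_bit_bl_code: "code_bit (bl_code \<sigma>) j \<longleftrightarrow> j < length \<sigma> \<and> \<sigma> ! j"
  by (auto simp: bl_code_def code_bit_list_encode)

lemma length_le_iff_code_drop: "length \<sigma> \<le> n \<longleftrightarrow> code_drop (bl_code \<sigma>) n = 0"
  by (simp add: bl_code_def code_drop_list_encode list_encode_eq_0_iff)

lemma code_len_bl_code [simp]: "code_len (bl_code \<sigma>) = length \<sigma>"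
  by (simp add: bl_code_def code_len_list_encode)

lemma bl_decode_bl_code [simp]: "bl_decode (bl_code \<sigma>) = \<sigma>"
  by (simp add: bl_decode_def bl_code_def comp_def)

lemma length_pre [simp]: "length (pre X n) = n"
  by (simp add: pre_def)

lemma nth_pre [simp]: "i < n \<Longrightarrow> pre X n ! i = X i"
  by (simp add: pre_def)

lemma pre_eq_iff: "pre X n = pre Y n \<longleftrightarrow> (\<forall>i<n. X i = Y i)"
  by (auto simp: pre_def)

text \<open>Every string becomes a prefix of an infinite sequence of decidable bits. Functions of
  strings can thus be treated throughout as functions of a sequence and a length.\<close>

lemma bl_decode_eq_pre: "bl_decode c = pre (code_bit c) (code_len c)"
proof -
  have "bl_decode (list_encode xs) = pre (code_bit (list_encode xs)) (code_len (list_encode xs))" for xs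
    by (rule nth_equalityI) (simp_all add: bl_decode_def code_len_list_encode code_bit_list_encode)
  from this[of "list_decode c"] show ?thesis by simp
qed

lemma pre_code_bit_bl_code [simp]: "pre (code_bit (bl_code \<sigma>)) (length \<sigma>) = \<sigma>"
  using bl_decode_eq_pre[of "bl_code \<sigma>"] by simp

lemma computable_code_drop [cintro]:
  "computable f \<Longrightarrow> computable g \<Longrightarrow> computable (\<lambda>x. code_drop (f x) (g x))"
  unfolding code_drop_def by (intro cintro)

lemma computable_code_bit [cintro]:
  "computable f \<Longrightarrow> computable g \<Longrightarrow> computable (\<lambda>x. of_bool (code_bit (f x) (g x)))"
  unfolding code_bit_def by (intro cintro)

lemma computable_code_len [cintro]:
  assumes "computable f" shows "computable (\<lambda>x. code_len (f x))"
proof -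
  have "computable (\<lambda>c. LEAST n. code_drop c n = 0)"
  proof (rule computable_Least)
    show "\<exists>n. code_drop c n = 0" for c
      using code_drop_list_encode[of "list_decode c" "length (list_decode c)"] by auto
  qed (intro cintro)
  from computable_comp[OF this assms] show ?thesis by (simp add: code_len_def)
qed

lemma computable_pre [cintro]:
  assumes b: "computable (\<lambda>z. of_bool (b (pfst z) (psnd z)))" and n: "computable n"
  shows "computable (\<lambda>x. bl_code (pre (b x) (n x)))"
proof -
  \<comment> \<open>List codes grow at the front, so the recursion runs backwards: after r steps it
    holds the code of the last r bits.\<close>
  let ?L = "\<lambda>x r. rec_nat 0 (\<lambda>r c. Suc (pair (of_bool (b x (n x - Suc r))) c)) r"
  have "?L x r = list_encode (map of_bool (map (b x) [n x - r..<n x]))" if "r \<le> n x" for x r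
    using that
  proof (induction r)
    case (Suc r)
    then have "[n x - Suc r..<n x] = (n x - Suc r) # [n x - r..<n x]"
      by (simp add: upt_conv_Cons Suc_diff_Suc)
    then show ?case using Suc by simp
  qed simp
  from this[of "n _"] have "bl_code (pre (b x) (n x)) = ?L x (n x)" for x
    by (simp add: bl_code_def pre_def comp_def)
  moreover have "computable (\<lambda>x. ?L x (n x))"
    by (intro cintro computable_comp_pair[of "\<lambda>x y. of_bool (b x y)", OF b] n computable_comp[OF n])
  ultimately show ?thesis by simp
qed

lemma computable_bit [cintro]:
  fixes f :: "nat \<Rightarrow> nat"
  assumes "computable f" "computable g"
  shows "computable (\<lambda>x. of_bool (bit (f x) (g x)))"
  unfolding bit_iff_odd by (intro cintro assms)

text \<open>Binary expansions of the numbers below 2^n run through all prefixes of length n, without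
  repetition by \<open>pre_bit_inj\<close>. Sums over strings become sums over an initial segment of
  the numbers, with \<open>bit i\<close> as a decidable representative of its cylinder.\<close>

lemma pre_bit_exists: "\<exists>i<2 ^ n. pre X n = pre (bit (i::nat)) n"
proof (intro exI conjI)
  let ?i = "horner_sum of_bool 2 (map X [0..<n]) :: nat"
  show "?i < 2 ^ n" using horner_sum_of_bool_2_less[of "map X [0..<n]"] by simp
  show "pre X n = pre (bit ?i) n" by (simp add: pre_eq_iff bit_horner_sum_bit_iff)
qed

lemma pre_bit_inj:
  assumes "i < 2 ^ n" "j < 2 ^ n" "pre (bit (i::nat)) n = pre (bit j) n" shows "i = j"
proof (rule bit_eqI)
  fix m
  show "bit i m = bit j m"
  proof (cases "m < n")
    case False
    then have "(2::nat) ^ n \<le> 2 ^ m" by simp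
    with assms(1,2) have "i < 2 ^ m" "j < 2 ^ m" by linarith+
    then show ?thesis by (simp add: bit_iff_odd)
  qed (use assms(3) in \<open>auto simp: pre_eq_iff\<close>)
qed

subsection \<open>Uniformly computable sequences of nonnegative reals\<close>

text \<open>Natural numerators over the denominator 2^n; this forces the reals to be nonnegative. An
  error of two units instead of one leaves room for one rounding by integer division.\<close>

definition computable_reals :: "(nat \<Rightarrow> real) \<Rightarrow> bool" where
  "computable_reals F \<longleftrightarrow> (\<exists>h. computable h \<and> (\<forall>a n. \<bar>real (h (pair a n)) - 2 ^ n * F a\<bar> \<le> 2))"

lemma abs_nat_div_diff_le: "\<bar>real (m div n) - real m / real n\<bar> \<le> 1"
  using of_int_floor_le[of "real m / real n"] floor_correct[of "real m / real n"]
  by (simp add: floor_divide_of_nat_eq)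

text \<open>Work at a finer precision N and divide by 2^(N - n): an error of 2^(N - n) shrinks to
  one unit, and the division adds at most another.\<close>

lemma computable_realsI:
  assumes h: "computable h" and N: "computable N"
    and le: "\<And>a n. n \<le> N (pair a n)"
    and err: "\<And>a n. \<bar>real (h (pair a n)) - 2 ^ N (pair a n) * F a\<bar> \<le> 2 ^ (N (pair a n) - n)"
  shows "computable_reals F"
  unfolding computable_reals_def
proof (intro exI conjI allI)
  let ?h = "\<lambda>z. h z div 2 ^ (N z - psnd z)"
  show "computable ?h" by (intro cintro h N)
  fix a n
  define H d where "H = h (pair a n)" and "d = N (pair a n) - n"
  have N': "N (pair a n) = n + d" using le[of n a] by (simp add: d_def)
  have "\<bar>real H - 2 ^ (n + d) * F a\<bar> \<le> 2 ^ d" using err[of a n] by (simp add: H_def N')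
  then have "\<bar>real H / 2 ^ d - 2 ^ n * F a\<bar> \<le> 1"
    by (simp add: power_add field_simps abs_le_iff)
  moreover have "\<bar>real (H div 2 ^ d) - real H / 2 ^ d\<bar> \<le> 1"
    using abs_nat_div_diff_le[of H "2 ^ d"] by simp
  ultimately show "\<bar>real (?h (pair a n)) - 2 ^ n * F a\<bar> \<le> 2"
    unfolding psnd_pair H_def[symmetric] d_def[symmetric] by linarith
qed

lemma computable_reals_of_nat [intro]:
  assumes "computable g" shows "computable_reals (\<lambda>a. real (g a))"
proof (rule computable_realsI)
  show "computable (\<lambda>z. 2 ^ psnd z * g (pfst z))" by (intro cintro assms computable_comp[OF assms])
qed (auto intro: computable_prod_decode)

lemma computable_reals_add:
  assumes "computable_reals F" "computable_reals G" shows "computable_reals (\<lambda>a. F a + G a)"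
proof -
  obtain h where h: "computable h" "\<And>a n. \<bar>real (h (pair a n)) - 2 ^ n * F a\<bar> \<le> 2"
    using assms(1) by (auto simp: computable_reals_def)
  obtain k where k: "computable k" "\<And>a n. \<bar>real (k (pair a n)) - 2 ^ n * G a\<bar> \<le> 2"
    using assms(2) by (auto simp: computable_reals_def)
  let ?z = "\<lambda>z. pair (pfst z) (psnd z + 2)"
  show ?thesis
  proof (rule computable_realsI)
    show "computable (\<lambda>z. h (?z z) + k (?z z))" "computable (\<lambda>z. psnd z + 2)"
      by (intro cintro computable_comp[OF h(1)] computable_comp[OF k(1)])+
    show "\<bar>real (h (?z (pair a n)) + k (?z (pair a n))) - 2 ^ (psnd (pair a n) + 2) * (F a + G a)\<bar>
       \<le> 2 ^ (psnd (pair a n) + 2 - n)" for a n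
      using h(2)[of a "n + 2"] k(2)[of a "n + 2"] by (simp add: distrib_left)
  qed auto
qed

text \<open>Truncated subtraction of the numerators is exactly \<open>max 0\<close> of their
  difference, and \<open>max 0\<close> does not enlarge errors. The two errors of 2 add up to 4,
  hence two extra bits.\<close>

lemma computable_reals_diff:
  assumes "computable_reals F" "computable_reals G" shows "computable_reals (\<lambda>a. max 0 (F a - G a))"
proof -
  obtain h where h: "computable h" "\<And>a n. \<bar>real (h (pair a n)) - 2 ^ n * F a\<bar> \<le> 2"
    using assms(1) by (auto simp: computable_reals_def)
  obtain k where k: "computable k" "\<And>a n. \<bar>real (k (pair a n)) - 2 ^ n * G a\<bar> \<le> 2"
    using assms(2) by (auto simp: computable_reals_def)
  let ?z = "\<lambda>z. pair (pfst z) (psnd z + 2)"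
  show ?thesis
  proof (rule computable_realsI)
    show "computable (\<lambda>z. h (?z z) - k (?z z))" "computable (\<lambda>z. psnd z + 2)"
      by (intro cintro computable_comp[OF h(1)] computable_comp[OF k(1)])+
    show "\<bar>real (h (?z (pair a n)) - k (?z (pair a n))) - 2 ^ (psnd (pair a n) + 2) * max 0 (F a - G a)\<bar>
       \<le> 2 ^ (psnd (pair a n) + 2 - n)" for a n
    proof -
      have "2 ^ (n + 2) * max 0 (F a - G a) = max 0 (2 ^ (n + 2) * F a - 2 ^ (n + 2) * G a)"
        by (simp add: max_mult_distrib_left right_diff_distrib)
      moreover have "real (x - y) = max 0 (real x - real y)" for x y by simp
      moreover have "\<bar>max 0 (x - y) - max 0 (p - q)\<bar> \<le> 2 ^ (n + 2 - n)"
        if "\<bar>x - p\<bar> \<le> 2" "\<bar>y - q\<bar> \<le> 2" for x y p q :: real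
        using that by (simp add: max_def abs_le_iff)
      ultimately show ?thesis
        using h(2)[of a "n + 2"] k(2)[of a "n + 2"]
        unfolding psnd_pair pfst_pair by (simp only:)
    qed
  qed auto
qed

lemma nat_le_power_2: "real n \<le> 2 ^ n"
  using of_nat_less_two_power[of n, where 'a=real] by simp

text \<open>The factor g a multiplies an error of 2, and g a \<le> 2^(g a), so g a + 1 extra bits
  suffice.\<close>

lemma computable_reals_mult_nat:
  assumes "computable_reals F" "computable g" shows "computable_reals (\<lambda>a. real (g a) * F a)"
proof -
  obtain h where h: "computable h" "\<And>a n. \<bar>real (h (pair a n)) - 2 ^ n * F a\<bar> \<le> 2"
    using assms(1) by (auto simp: computable_reals_def)
  show ?thesis
  proof (rule computable_realsI)
    show "computable (\<lambda>z. g (pfst z) * h (pair (pfst z) (psnd z + g (pfst z) + 1)))"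
      "computable (\<lambda>z. psnd z + g (pfst z) + 1)"
      by (intro cintro computable_comp[OF h(1)] computable_comp[OF assms(2)])+
    show "\<bar>real (g (pfst (pair a n)) * h (pair (pfst (pair a n)) (psnd (pair a n) + g (pfst (pair a n)) + 1)))
      - 2 ^ (psnd (pair a n) + g (pfst (pair a n)) + 1) * (real (g a) * F a)\<bar>
      \<le> 2 ^ (psnd (pair a n) + g (pfst (pair a n)) + 1 - n)" for a n
    proof -
      define m where "m = n + g a + 1"
      have "real (g a * h (pair a m)) - 2 ^ m * (real (g a) * F a)
        = real (g a) * (real (h (pair a m)) - 2 ^ m * F a)" by (simp add: algebra_simps)
      then have "\<bar>real (g a * h (pair a m)) - 2 ^ m * (real (g a) * F a)\<bar>
        = real (g a) * \<bar>real (h (pair a m)) - 2 ^ m * F a\<bar>" by (simp add: abs_mult)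
      also have "\<dots> \<le> 2 ^ g a * 2"
        by (rule mult_mono[OF nat_le_power_2 h(2)]) auto
      also have "\<dots> = 2 ^ (m - n)" by (simp add: m_def)
      finally show ?thesis by (simp add: m_def)
    qed
  qed auto
qed

lemma computable_reals_div_power:
  assumes "computable_reals F" "computable g" shows "computable_reals (\<lambda>a. F a / 2 ^ g a)"
proof -
  obtain h where h: "computable h" "\<And>a n. \<bar>real (h (pair a n)) - 2 ^ n * F a\<bar> \<le> 2"
    using assms(1) by (auto simp: computable_reals_def)
  let ?h = "\<lambda>z. h (pair (pfst z) (psnd z + 2)) div 2 ^ g (pfst z)"
  show ?thesis
  proof (rule computable_realsI)
    show "computable ?h" "computable (\<lambda>z. psnd z + 2)"
      by (intro cintro computable_comp[OF h(1)] computable_comp[OF assms(2)])+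
    show "\<bar>real (?h (pair a n)) - 2 ^ (psnd (pair a n) + 2) * (F a / 2 ^ g a)\<bar>
      \<le> 2 ^ (psnd (pair a n) + 2 - n)" for a n
    proof -
      define H where "H = h (pair a (n + 2))"
      have "\<bar>real H - 2 ^ (n + 2) * F a\<bar> / 2 ^ g a \<le> 2 / 1"
        using h(2)[of a "n + 2"] unfolding H_def by (intro frac_le) auto
      moreover have "\<bar>real H - 2 ^ (n + 2) * F a\<bar> / 2 ^ g a = \<bar>real H / 2 ^ g a - 2 ^ (n + 2) * (F a / 2 ^ g a)\<bar>"
        by (simp only: times_divide_eq_right diff_divide_distrib[symmetric] abs_divide) simp
      moreover have "\<bar>real (H div 2 ^ g a) - real H / 2 ^ g a\<bar> \<le> 1"
        using abs_nat_div_diff_le[of H "2 ^ g a"] by simp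
      moreover have "(2::real) ^ (n + 2 - n) = 4" by simp
      ultimately show ?thesis
        unfolding psnd_pair pfst_pair H_def[symmetric] by linarith
    qed
  qed auto
qed

lemma computable_reals_sum:
  assumes "computable_reals (\<lambda>z. F (pfst z) (psnd z))" "computable l"
  shows "computable_reals (\<lambda>a. \<Sum>i<l a. F a i)"
proof -
  obtain h where h: "computable h" "\<And>a n. \<bar>real (h (pair a n)) - 2 ^ n * F (pfst a) (psnd a)\<bar> \<le> 2"
    using assms(1) by (auto simp: computable_reals_def)
  let ?N = "\<lambda>z. psnd z + l (pfst z) + 1"
  let ?h = "\<lambda>z. \<Sum>i<l (pfst z). h (pair (pair (pfst z) i) (?N z))"
  show ?thesis
  proof (rule computable_realsI)
    show "computable ?h" "computable ?N"
      by (intro cintro computable_comp[OF h(1)] computable_comp[OF assms(2)])+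
    show "\<bar>real (?h (pair a n)) - 2 ^ (?N (pair a n)) * (\<Sum>i<l a. F a i)\<bar> \<le> 2 ^ (?N (pair a n) - n)" for a n
    proof -
      define m where "m = n + l a + 1"
      have "\<bar>real (\<Sum>i<l a. h (pair (pair a i) m)) - 2 ^ m * (\<Sum>i<l a. F a i)\<bar>
         = \<bar>\<Sum>i<l a. real (h (pair (pair a i) m)) - 2 ^ m * F a i\<bar>"
        by (simp add: sum_distrib_left sum_subtractf)
      also have "\<dots> \<le> (\<Sum>i<l a. \<bar>real (h (pair (pair a i) m)) - 2 ^ m * F a i\<bar>)" by (rule sum_abs)
      also have "\<dots> \<le> (\<Sum>i<l a. 2)" using h(2)[of "pair a _" m] by (intro sum_mono) simp
      also have "\<dots> \<le> 2 ^ l a * 2" using nat_le_power_2[of "l a"] by simp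
      also have "\<dots> = 2 ^ (m - n)" by (simp add: m_def)
      finally show ?thesis by (simp add: m_def)
    qed
  qed auto
qed

text \<open>Taken at index and precision n + 2, the limit contributes an error of one unit and the
  numerator two, which together stay below 2^2.\<close>

lemma computable_reals_limit:
  assumes "computable_reals (\<lambda>z. G (pfst z) (psnd z))" "\<And>a n. \<bar>F a - G a n\<bar> \<le> 1 / 2 ^ n"
  shows "computable_reals F"
proof -
  obtain h where h: "computable h" "\<And>a n. \<bar>real (h (pair a n)) - 2 ^ n * G (pfst a) (psnd a)\<bar> \<le> 2"
    using assms(1) by (auto simp: computable_reals_def)
  show ?thesis
  proof (rule computable_realsI)
    show "computable (\<lambda>z. h (pair (pair (pfst z) (psnd z + 2)) (psnd z + 2)))" "computable (\<lambda>z. psnd z + 2)"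
      by (intro cintro computable_comp[OF h(1)])+
    show "\<bar>real (h (pair (pair (pfst (pair a n)) (psnd (pair a n) + 2)) (psnd (pair a n) + 2)))
      - 2 ^ (psnd (pair a n) + 2) * F a\<bar> \<le> 2 ^ (psnd (pair a n) + 2 - n)" for a n
    proof -
      define m where "m = n + 2"
      have "\<bar>F a - G a m\<bar> * 2 ^ m \<le> 1" using assms(2)[of a m] by (simp add: field_simps)
      moreover have "\<bar>2 ^ m * F a - 2 ^ m * G a m\<bar> = \<bar>F a - G a m\<bar> * 2 ^ m"
        by (simp add: abs_mult flip: right_diff_distrib)
      moreover have "\<bar>real (h (pair (pair a m) m)) - 2 ^ m * G a m\<bar> \<le> 2" using h(2)[of "pair a m" m] by simp
      moreover have "(2::real) ^ (n + 2 - n) = 4" by simp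
      ultimately show ?thesis
        unfolding psnd_pair pfst_pair m_def[symmetric] by (simp add: m_def)
    qed
  qed auto
qed

lemma computable_measure_reals:
  assumes "computable_measure M" "computable c"
  shows "computable_reals (\<lambda>a. measure M (cyl (bl_decode (c a))))"
proof -
  obtain f where f: "computable f"
    and fM: "\<And>\<sigma> n. \<bar>rat_decode (f (pair (bl_code \<sigma>) n)) - measure M (cyl \<sigma>)\<bar> \<le> (1/2) ^ n"
    using assms(1) by (auto simp: computable_measure_def)
  \<comment> \<open>The approximation \<open>f\<close> is specified on codes of the form
    \<open>bl_code \<sigma>\<close> only, whereas \<open>bl_decode\<close> accepts any number; the
    code is therefore normalised.\<close>
  let ?c = "\<lambda>z. bl_code (pre (code_bit (c (pfst z))) (code_len (c (pfst z))))"
  let ?r = "\<lambda>z. f (pair (?c z) (psnd z))"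
  \<comment> \<open>An odd sign component marks a value that is not positive. It is replaced by 0,
    which is no further from the nonnegative measure.\<close>
  let ?h = "\<lambda>z. if odd (pfst (?r z)) then 0 else (2 ^ psnd z * pfst (psnd (?r z))) div Suc (psnd (psnd (?r z)))"
  have r: "computable ?r"
    by (intro computable_comp[OF f] cintro computable_comp[OF assms(2)])
  show ?thesis
    unfolding computable_reals_def
  proof (intro exI conjI allI)
    show "computable ?h" by (intro cintro r)
    fix a n
    define \<sigma> where "\<sigma> = bl_decode (c a)"
    define s p q where "s = pfst (?r (pair a n))" and "p = pfst (psnd (?r (pair a n)))"
      and "q = psnd (psnd (?r (pair a n)))"
    have c: "?r (pair a n) = f (pair (bl_code \<sigma>) n)" by (simp add: \<sigma>_def bl_decode_eq_pre)
    have "rat_decode (?r (pair a n)) = (if even s then 1 else -1) * real p / real (Suc q)"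
      by (simp add: rat_decode_def s_def p_def q_def pfst_def psnd_def case_prod_beta)
    then have "\<bar>(if even s then 1 else -1) * real p / real (Suc q) - measure M (cyl \<sigma>)\<bar> \<le> (1/2) ^ n"
      using fM[of \<sigma> n] unfolding c by (simp only:)
    then have "2 ^ n * \<bar>(if even s then 1 else -1) * real p / real (Suc q) - measure M (cyl \<sigma>)\<bar> \<le> 1"
      by (simp add: field_simps power_one_over)
    moreover have "2 ^ n * \<bar>(if even s then 1 else -1) * real p / real (Suc q) - measure M (cyl \<sigma>)\<bar>
      = \<bar>2 ^ n * ((if even s then 1 else -1) * real p / real (Suc q)) - 2 ^ n * measure M (cyl \<sigma>)\<bar>"
      by (simp only: abs_mult right_diff_distrib[symmetric]) simp
    ultimately have e: "\<bar>2 ^ n * ((if even s then 1 else -1) * real p / real (Suc q)) - 2 ^ n * measure M (cyl \<sigma>)\<bar> \<le> 1"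
      by simp
    have h: "?h (pair a n) = (if odd s then 0 else (2 ^ n * p) div Suc q)"
      by (simp add: s_def p_def q_def)
    have nn: "0 \<le> 2 ^ n * measure M (cyl \<sigma>)" by simp
    show "\<bar>real (?h (pair a n)) - 2 ^ n * measure M (cyl (bl_decode (c a)))\<bar> \<le> 2"
    proof (cases "even s")
      case True
      have "\<bar>real ((2 ^ n * p) div Suc q) - real (2 ^ n * p) / real (Suc q)\<bar> \<le> 1"
        by (rule abs_nat_div_diff_le)
      then show ?thesis using True e unfolding h \<sigma>_def[symmetric] by simp
    next
      case False
      have "0 \<le> 2 ^ n * (real p / real (Suc q))" by simp
      moreover have "\<bar>- (2 ^ n * (real p / real (Suc q))) - 2 ^ n * measure M (cyl \<sigma>)\<bar> \<le> 1"
        using e False by simp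
      ultimately show ?thesis
        using nn unfolding h \<sigma>_def[symmetric] if_P[OF False] of_nat_0 by linarith
    qed
  qed
qed

lemma computable_measure_pre:
  assumes "computable_measure M" "computable (\<lambda>z. of_bool (b (pfst z) (psnd z)))" "computable n"
  shows "computable_reals (\<lambda>a. measure M (cyl (pre (b a) (n a))))"
  using computable_measure_reals[OF assms(1) computable_pre[OF assms(2,3)]] by simp

lemma computable_measureI:
  assumes "sets M = sets cantor" "finite_measure M"
    and "computable_reals (\<lambda>c. measure M (cyl (bl_decode c)))"
  shows "computable_measure M"
proof -
  obtain h where h: "computable h" "\<And>a n. \<bar>real (h (pair a n)) - 2 ^ n * measure M (cyl (bl_decode a))\<bar> \<le> 2"
    using assms(3) by (auto simp: computable_reals_def)
  \<comment> \<open>The component 0 encodes the positive sign. The stored denominator is one less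
    than 2^(n + 1) because \<open>rat_decode\<close> divides by a successor; at precision n + 1 an
    error of two units is 2^-n.\<close>
  let ?f = "\<lambda>z. pair 0 (pair (h (pair (pfst z) (Suc (psnd z)))) (2 ^ Suc (psnd z) - 1))"
  have "computable ?f" by (intro cintro computable_comp[OF h(1)])
  moreover have "\<bar>rat_decode (?f (pair (bl_code \<sigma>) n)) - measure M (cyl \<sigma>)\<bar> \<le> (1/2) ^ n" for \<sigma> n
  proof -
    define H where "H = h (pair (bl_code \<sigma>) (Suc n))"
    have "rat_decode (?f (pair (bl_code \<sigma>) n)) = real H / 2 ^ Suc n"
      by (simp add: rat_decode_def H_def)
    moreover have "\<bar>real H - 2 ^ Suc n * measure M (cyl \<sigma>)\<bar> \<le> 2" using h(2)[of "bl_code \<sigma>" "Suc n"] by (simp add: H_def)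
    then have "\<bar>real H / 2 ^ Suc n - measure M (cyl \<sigma>)\<bar> \<le> 1 / 2 ^ n"
      by (simp add: field_simps abs_le_iff)
    ultimately show ?thesis by (simp add: power_one_over)
  qed
  ultimately show ?thesis using assms(1,2) by (auto simp: computable_measure_def)
qed

subsection \<open>Measures on Cantor space\<close>

lemma space_cantor [simp]: "space cantor = UNIV"
  by (simp add: cantor_def space_PiM)

lemma bit_measurable [measurable]: "Measurable.pred cantor (\<lambda>X. X n)"
proof -
  have "(\<lambda>X. X n) \<in> measurable cantor (count_space UNIV)"
    unfolding cantor_def by (rule measurable_component_singleton) simp
  then show ?thesis by simp
qed

lemma measurable_cantorI:
  assumes "\<And>n. Measurable.pred M (\<lambda>x. f x n)"
  shows "f \<in> measurable M cantor"
  unfolding cantor_def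
  by (rule measurable_PiM_single') (use assms in auto)

lemma mem_cyl_iff: "X \<in> cyl \<sigma> \<longleftrightarrow> pre X (length \<sigma>) = \<sigma>"
  by (simp add: cyl_def)

lemma mem_cyl_pre: "X \<in> cyl (pre Y n) \<longleftrightarrow> pre X n = pre Y n"
  by (simp add: cyl_def)

lemma cyl_Nil [simp]: "cyl [] = UNIV"
  by (simp add: cyl_def pre_def)

lemma pre_Suc: "pre X (Suc n) = pre X n @ [X n]"
  by (simp add: pre_def)

lemma cyl_split: "cyl \<sigma> = cyl (\<sigma> @ [False]) \<union> cyl (\<sigma> @ [True])"
  by (auto simp: mem_cyl_iff pre_Suc)

lemma cyl_split_disjoint: "cyl (\<sigma> @ [False]) \<inter> cyl (\<sigma> @ [True]) = {}"
  by (auto simp: mem_cyl_iff pre_Suc)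

lemma take_pre: "take m (pre X n) = pre X (min m n)"
  by (simp add: pre_def take_map min_def)

lemma pre_eq_mono: "pre X n = pre Y n \<Longrightarrow> m \<le> n \<Longrightarrow> pre X m = pre Y m"
  by (auto simp: pre_eq_iff)

lemma finite_bool_lists: "finite {\<sigma> :: bool list. length \<sigma> = n}"
  using finite_lists_length_eq[of "UNIV :: bool set" n] by simp

lemma cyl_measurable [measurable]: "cyl \<sigma> \<in> sets cantor"
proof -
  have "cyl \<sigma> = {X \<in> space cantor. \<forall>i<length \<sigma>. X i = \<sigma> ! i}"
    unfolding cyl_def by (subst list_eq_iff_nth_eq) simp
  also have "\<dots> \<in> sets cantor" by measurable
  finally show ?thesis .
qed

lemma pred_pre_measurable [measurable]: "Measurable.pred cantor (\<lambda>X. P (pre X n))"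
proof -
  have "{X. P (pre X n)} = (\<Union>\<sigma>\<in>{\<sigma>. length \<sigma> = n \<and> P \<sigma>}. cyl \<sigma>)"
    by (auto simp: mem_cyl_iff)
  also have "\<dots> \<in> sets cantor"
    by (rule sets.finite_UN) (auto intro: finite_subset[OF _ finite_bool_lists[of n]])
  finally show ?thesis by (simp add: pred_def)
qed

lemma fun_pre_measurable [measurable]: "(\<lambda>X. f (pre X n)) \<in> borel_measurable cantor"
proof -
  have "(\<lambda>X. pre X n) \<in> measurable cantor (count_space UNIV)"
    by (subst measurable_count_space_eq2_countable) (use pred_pre_measurable[of "\<lambda>\<sigma>. \<sigma> = _" n] in \<open>auto simp: vimage_def pred_def\<close>)
  then show ?thesis by measurable
qed

lemma nn_integral_sum_cyl:
  assumes M: "sets M = sets cantor" and f: "f \<in> borel_measurable M"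
  shows "(\<integral>\<^sup>+X. f X \<partial>M) = (\<Sum>i<2 ^ n. \<integral>\<^sup>+X\<in>cyl (pre (bit (i::nat)) n). f X \<partial>M)"
proof -
  have "(\<integral>\<^sup>+X. f X \<partial>M) = (\<integral>\<^sup>+X. (\<Sum>i<2 ^ n. f X * indicator (cyl (pre (bit (i::nat)) n)) X) \<partial>M)"
  proof (intro nn_integral_cong)
    fix X
    obtain i where i: "i < 2 ^ n" "pre X n = pre (bit (i::nat)) n" using pre_bit_exists by blast
    have "(\<Sum>j<2 ^ n. f X * indicator (cyl (pre (bit (j::nat)) n)) X) = (\<Sum>j<2 ^ n. if j = i then f X else 0)"
      using i by (intro sum.cong) (auto simp: indicator_def mem_cyl_iff dest: pre_bit_inj)
    then show "f X = (\<Sum>i<2 ^ n. f X * indicator (cyl (pre (bit (i::nat)) n)) X)" using i by simp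
  qed
  also have "\<dots> = (\<Sum>i<2 ^ n. \<integral>\<^sup>+X\<in>cyl (pre (bit (i::nat)) n). f X \<partial>M)"
    by (rule nn_integral_sum) (use f M in measurable)
  finally show ?thesis .
qed

lemma measure_locally_constant:
  assumes M: "sets M = sets cantor" "finite_measure M"
    and D: "\<And>X Y. pre X l = pre Y l \<Longrightarrow> D X = (D Y :: nat)"
  shows "(\<integral>\<^sup>+X. of_nat (D X) \<partial>M) = ennreal (\<Sum>i<2 ^ l. real (D (bit i)) * measure M (cyl (pre (bit (i::nat)) l)))"
proof -
  interpret finite_measure M by fact
  define g where "g = (\<lambda>\<sigma>. D (\<lambda>i. if i < l then \<sigma> ! i else False))"
  have Dg: "D X = g (pre X l)" for X unfolding g_def by (rule D) (simp add: pre_eq_iff)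
  have [measurable]: "(\<lambda>X. (of_nat (D X) :: ennreal)) \<in> borel_measurable M"
    unfolding Dg using fun_pre_measurable[of "\<lambda>\<sigma>. of_nat (g \<sigma>)" l] M(1) by (simp cong: measurable_cong_sets)
  have "(\<integral>\<^sup>+X. of_nat (D X) \<partial>M) = (\<Sum>i<2 ^ l. \<integral>\<^sup>+X\<in>cyl (pre (bit (i::nat)) l). of_nat (D X) \<partial>M)"
    by (rule nn_integral_sum_cyl) (use M in measurable)
  also have "\<dots> = (\<Sum>i<2 ^ l. \<integral>\<^sup>+X. of_nat (D (bit i)) * indicator (cyl (pre (bit (i::nat)) l)) X \<partial>M)"
  proof (rule sum.cong[OF refl])
    fix i
    have "of_nat (D X) * indicator (cyl (pre (bit (i::nat)) l)) X
      = (of_nat (D (bit i)) * indicator (cyl (pre (bit (i::nat)) l)) X :: ennreal)" for X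
      using D[of X "bit i"] by (cases "pre X l = pre (bit i) l") (auto simp: mem_cyl_iff indicator_def)
    then show "(\<integral>\<^sup>+X\<in>cyl (pre (bit (i::nat)) l). of_nat (D X) \<partial>M)
      = (\<integral>\<^sup>+X. of_nat (D (bit i)) * indicator (cyl (pre (bit (i::nat)) l)) X \<partial>M)" by simp
  qed
  also have "\<dots> = (\<Sum>i<2 ^ l. of_nat (D (bit i)) * ennreal (measure M (cyl (pre (bit (i::nat)) l))))"
    using M(1) by (simp add: nn_integral_cmult_indicator emeasure_eq_measure)
  also have "\<dots> = (\<Sum>i<2 ^ l. ennreal (real (D (bit i)) * measure M (cyl (pre (bit (i::nat)) l))))"
    by (simp add: ennreal_mult ennreal_of_nat_eq_real_of_nat)
  also have "\<dots> = ennreal (\<Sum>i<2 ^ l. real (D (bit i)) * measure M (cyl (pre (bit (i::nat)) l)))"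
    by (rule sum_ennreal) simp
  finally show ?thesis .
qed

text \<open>An integrand determined by the first \<open>l a\<close> bits integrates to a finite
  weighted sum of cylinder measures, and its weights are its values at the points
  \<open>bit i\<close>.\<close>

lemma computable_reals_integral:
  assumes M: "computable_measure M"
    and D: "\<And>a X Y. pre X (l a) = pre Y (l a) \<Longrightarrow> D a X = (D a Y :: nat)"
    and c: "computable (\<lambda>z. D (pfst z) (bit (psnd z)))" "computable l"
  shows "computable_reals (\<lambda>a. enn2real (\<integral>\<^sup>+X. of_nat (D a X) \<partial>M))"
proof -
  have M': "sets M = sets cantor" "finite_measure M" using M by (auto simp: computable_measure_def)
  have "enn2real (\<integral>\<^sup>+X. of_nat (D a X) \<partial>M) = (\<Sum>i<2 ^ l a. real (D a (bit i)) * measure M (cyl (pre (bit (i::nat)) (l a))))" for a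
    by (subst measure_locally_constant[OF M', of "l a"], erule D) (simp add: sum_nonneg)
  moreover have "computable_reals (\<lambda>a. \<Sum>i<2 ^ l a. real (D a (bit i)) * measure M (cyl (pre (bit (i::nat)) (l a))))"
    by (intro computable_reals_sum computable_reals_mult_nat computable_measure_pre[OF M] cintro c
        computable_comp[OF c(2)])
  ultimately show ?thesis by simp
qed

text \<open>The measure is the image of Lebesgue measure on an interval, successively cut into
  pieces of the prescribed lengths.\<close>
lemma measure_extension:
  fixes m :: "bool list \<Rightarrow> real"
  assumes nonneg: "\<And>\<sigma>. 0 \<le> m \<sigma>" and add: "\<And>\<sigma>. m \<sigma> = m (\<sigma> @ [False]) + m (\<sigma> @ [True])"
  shows "\<exists>M. sets M = sets cantor \<and> finite_measure M \<and> (\<forall>\<sigma>. measure M (cyl \<sigma>) = m \<sigma>)"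
proof -
  \<comment> \<open>Left end of the interval of \<sigma>: wherever the path turns to True, the mass
    of the False sibling lies to its left.\<close>
  define lo where "lo \<sigma> = (\<Sum>i<length \<sigma>. if \<sigma> ! i then m (take i \<sigma> @ [False]) else 0)" for \<sigma>
  have lo_snoc: "lo (\<sigma> @ [b]) = lo \<sigma> + (if b then m (\<sigma> @ [False]) else 0)" for \<sigma> b
  proof -
    have "(\<Sum>i<length \<sigma>. if (\<sigma> @ [b]) ! i then m (take i (\<sigma> @ [b]) @ [False]) else 0) = lo \<sigma>"
      unfolding lo_def by (intro sum.cong) (auto simp: nth_append)
    then show ?thesis by (simp add: lo_def)
  qed
  define st where "st x n = rec_nat [] (\<lambda>_ \<sigma>. \<sigma> @ [lo \<sigma> + m (\<sigma> @ [False]) \<le> x]) n" for x n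
  have st_0 [simp]: "st x 0 = []" for x by (simp add: st_def)
  have st_Suc: "st x (Suc n) = st x n @ [lo (st x n) + m (st x n @ [False]) \<le> x]" for x n by (simp add: st_def)
  have len [simp]: "length (st x n) = n" for x n by (induction n) (simp_all add: st_Suc)
  define path where "path x n = (lo (st x n) + m (st x n @ [False]) \<le> x)" for x n
  have pre_path: "pre (path x) n = st x n" for x n
    by (induction n) (simp_all add: pre_Suc st_Suc path_def, simp add: pre_def)
  \<comment> \<open>The intervals are half-open, so each x of a parent interval lies in exactly one
    child interval; this makes the statement an equivalence and the induction close.\<close>
  have st_iff: "st x n = \<sigma> \<longleftrightarrow> lo \<sigma> \<le> x \<and> x < lo \<sigma> + m \<sigma>" if "x \<in> {0..<m []}" "length \<sigma> = n" for x n \<sigma>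
    using that(2)
  proof (induction n arbitrary: \<sigma>)
    case 0
    then show ?case using that(1) by (simp add: lo_def)
  next
    case (Suc n)
    then obtain \<tau> b where \<sigma>: "\<sigma> = \<tau> @ [b]" "length \<tau> = n" by (metis length_Suc_conv_rev)
    show ?case
    proof (cases "st x n = \<tau>")
      case True
      then have "lo \<tau> \<le> x \<and> x < lo \<tau> + m \<tau>" using Suc.IH[OF \<sigma>(2)] by simp
      then show ?thesis using True add[of \<tau>] by (cases b) (auto simp: st_Suc \<sigma> lo_snoc)
    next
      case False
      then have "\<not> (lo \<tau> \<le> x \<and> x < lo \<tau> + m \<tau>)" using Suc.IH[OF \<sigma>(2)] by simp
      then show ?thesis using False add[of \<tau>] nonneg[of "\<tau> @ [False]"] nonneg[of "\<tau> @ [True]"]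
        by (cases b) (auto simp: st_Suc \<sigma> lo_snoc)
    qed
  qed
  define M0 where "M0 = restrict_space lborel {0..<m []}"
  have space_M0: "space M0 = {0..<m []}" by (simp add: M0_def space_restrict_space)
  have cyl_eq: "path -` cyl \<sigma> \<inter> space M0 = {lo \<sigma>..<lo \<sigma> + m \<sigma>} \<inter> {0..<m []}" for \<sigma>
  proof -
    have "path x \<in> cyl \<sigma> \<longleftrightarrow> lo \<sigma> \<le> x \<and> x < lo \<sigma> + m \<sigma>" if "x \<in> {0..<m []}" for x
      using st_iff[OF that refl] by (simp add: mem_cyl_iff pre_path)
    then show ?thesis unfolding set_eq_iff Int_iff vimage_eq space_M0 atLeastLessThan_iff by blast
  qed
  have cyl_sets: "path -` cyl \<sigma> \<inter> space M0 \<in> sets M0" for \<sigma>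
    unfolding cyl_eq unfolding M0_def sets_restrict_space by (subst Int_commute, rule imageI) simp
  have meas: "path \<in> measurable M0 cantor"
  proof (rule measurable_cantorI)
    fix n
    have "{x \<in> space M0. path x n} = (\<Union>\<sigma>\<in>{\<sigma>. length \<sigma> = Suc n \<and> \<sigma> ! n}. path -` cyl \<sigma> \<inter> space M0)"
      by (auto simp: mem_cyl_iff)
    also have "\<dots> \<in> sets M0"
      using cyl_sets by (intro sets.finite_UN) (auto intro: finite_subset[OF _ finite_bool_lists[of "Suc n"]])
    finally show "Measurable.pred M0 (\<lambda>x. path x n)" by (simp add: pred_def)
  qed
  have range: "0 \<le> lo \<sigma> \<and> lo \<sigma> + m \<sigma> \<le> m []" for \<sigma>
  proof (induction \<sigma> rule: rev_induct)
    case (snoc b \<sigma>)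
    then show ?case using add[of \<sigma>] nonneg[of "\<sigma> @ [False]"] nonneg[of "\<sigma> @ [True]"]
      by (cases b) (auto simp: lo_snoc)
  qed (simp add: lo_def)
  let ?M = "distr M0 cantor path"
  have em: "emeasure ?M (cyl \<sigma>) = ennreal (m \<sigma>)" for \<sigma>
  proof -
    have "emeasure ?M (cyl \<sigma>) = emeasure M0 ({lo \<sigma>..<lo \<sigma> + m \<sigma>} \<inter> {0..<m []})"
      by (simp add: emeasure_distr[OF meas] cyl_eq)
    also have "{lo \<sigma>..<lo \<sigma> + m \<sigma>} \<inter> {0..<m []} = {lo \<sigma>..<lo \<sigma> + m \<sigma>}" using range[of \<sigma>] by auto
    also have "emeasure M0 {lo \<sigma>..<lo \<sigma> + m \<sigma>} = emeasure lborel {lo \<sigma>..<lo \<sigma> + m \<sigma>}"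
      unfolding M0_def using range[of \<sigma>] by (intro emeasure_restrict_space) auto
    finally show ?thesis using nonneg[of \<sigma>] by simp
  qed
  have "finite_measure ?M"
    by (rule finite_measureI) (use em[of "[]"] in simp)
  moreover have "measure ?M (cyl \<sigma>) = m \<sigma>" for \<sigma> using em[of \<sigma>] nonneg[of \<sigma>] by (simp add: measure_def)
  ultimately show ?thesis by (intro exI[of _ ?M]) simp
qed

text \<open>Compactness by Koenig's argument: a string shared by infinitely many \<open>x n\<close>
  has an extension by one bit that is again shared by infinitely many, and following such extensions
  yields the limit.\<close>

lemma cantor_limit_point:
  fixes x :: "nat \<Rightarrow> nat \<Rightarrow> bool"
  shows "\<exists>X. \<forall>m. infinite {n. pre (x n) m = pre X m}"
proof -
  define Q where "Q \<sigma> \<longleftrightarrow> infinite {n. pre (x n) (length \<sigma>) = \<sigma>}" for \<sigma>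
  have Q0: "Q []" by (simp add: Q_def pre_def)
  have step: "\<exists>b. Q (\<sigma> @ [b])" if "Q \<sigma>" for \<sigma>
  proof (rule ccontr)
    assume "\<nexists>b. Q (\<sigma> @ [b])"
    then have "finite {n. pre (x n) (length (\<sigma> @ [b])) = \<sigma> @ [b]}" for b by (auto simp: Q_def)
    then have "finite (\<Union>b. {n. pre (x n) (length (\<sigma> @ [b])) = \<sigma> @ [b]})" by simp
    moreover have "{n. pre (x n) (length \<sigma>) = \<sigma>} \<subseteq> (\<Union>b. {n. pre (x n) (length (\<sigma> @ [b])) = \<sigma> @ [b]})"
      by (auto simp: pre_Suc)
    ultimately have "finite {n. pre (x n) (length \<sigma>) = \<sigma>}" by (rule finite_subset[rotated])
    then show False using that by (simp add: Q_def)
  qed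
  define f where "f n = rec_nat [] (\<lambda>_ \<sigma>. \<sigma> @ [SOME b. Q (\<sigma> @ [b])]) n" for n
  have f_Suc: "f (Suc n) = f n @ [SOME b. Q (f n @ [b])]" for n by (simp add: f_def)
  have Qf: "Q (f n)" for n
    by (induction n) (simp add: f_def Q0, simp only: f_Suc, rule someI_ex, rule step)
  define X where "X n = (SOME b. Q (f n @ [b]))" for n
  have "pre X n = f n" for n
    by (induction n) (simp add: f_def pre_def, simp add: pre_Suc f_Suc X_def)
  then show ?thesis using Qf unfolding Q_def by (intro exI[of _ X]) (metis length_pre)
qed

subsection \<open>Countability of the computable functions\<close>

text \<open>Names for the recursive functions, of which there are countably many. Arity and
  regularity are not recorded: surplus terms also evaluate to functions and merely enlarge the
  range.\<close>

datatype rec_term = RZero | RSucc | RProj nat | RComp rec_term "rec_term list"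
  | RPrim rec_term rec_term | RMini rec_term

instance rec_term :: countable
  by countable_datatype

primrec rec_eval :: "rec_term \<Rightarrow> nat list \<Rightarrow> nat" where
  "rec_eval RZero = (\<lambda>_. 0)"
| "rec_eval RSucc = (\<lambda>xs. Suc (hd xs))"
| "rec_eval (RProj i) = (\<lambda>xs. xs ! i)"
| "rec_eval (RComp f gs) = (\<lambda>xs. rec_eval f (map (\<lambda>g. g xs) (map rec_eval gs)))"
| "rec_eval (RPrim g h) = prim_rec_op (rec_eval g) (rec_eval h)"
| "rec_eval (RMini f) = (\<lambda>xs. LEAST y. rec_eval f (y # xs) = 0)"

lemma recfn_imp_rec_eval: "recfn n f \<Longrightarrow> f \<in> range rec_eval"
proof (induction rule: recfn.induct)
  case (comp m f gs n)
  then obtain t where t: "f = rec_eval t" by auto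
  have "\<exists>ts. map rec_eval ts = gs"
    using comp.IH(2) comp.hyps by (metis (no_types, lifting) ex_map_conv imageE)
  then obtain ts where "map rec_eval ts = gs" by blast
  then show ?case using t by (intro image_eqI[of _ _ "RComp t ts"]) auto
next
  case (zero n)
  show ?case by (rule image_eqI[of _ _ RZero]) auto
next
  case succ
  show ?case by (rule image_eqI[of _ _ RSucc]) auto
next
  case (proj i n)
  show ?case by (rule image_eqI[of _ _ "RProj i"]) auto
next
  case (prim n g h)
  then obtain a b where "g = rec_eval a" "h = rec_eval b" by auto
  then show ?case by (intro image_eqI[of _ _ "RPrim a b"]) auto
next
  case (mini n f)
  then obtain a where "f = rec_eval a" by auto
  then show ?case by (intro image_eqI[of _ _ "RMini a"]) auto
qed

lemma countable_computable: "countable {f. computable f}"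
proof (rule countable_subset)
  show "{f. computable f} \<subseteq> range (\<lambda>t x. rec_eval t [x])"
  proof
    fix f assume "f \<in> {f. computable f}"
    then obtain g where g: "recfn 1 g" "\<And>x. f x = g [x]" by (auto simp: computable_def)
    then obtain t where "g = rec_eval t" using recfn_imp_rec_eval by blast
    then show "f \<in> range (\<lambda>t x. rec_eval t [x])" using g(2) by auto
  qed
qed auto

subsection \<open>Martingales with savings\<close>

lemma measure_cyl_split:
  assumes "sets M = sets cantor" "finite_measure M"
  shows "measure M (cyl \<sigma>) = measure M (cyl (\<sigma> @ [False])) + measure M (cyl (\<sigma> @ [True]))"
proof -
  interpret finite_measure M by fact
  show ?thesis
    by (subst cyl_split, rule finite_measure_Union) (use assms cyl_split_disjoint in auto)
qed

lemma computable_measure_approx: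
  assumes "computable_measure M"
  obtains h where "computable h" "\<And>c n. \<bar>real (h (pair c n)) - 2 ^ n * measure M (cyl (bl_decode c))\<bar> \<le> 2"
  using computable_measure_reals[OF assms computable_id] by (auto simp: computable_reals_def)

text \<open>The betting capital is \<open>K / \<nu>\<close> together with the strictly positive capital of Lebesgue measure.
  Whenever the active part of the capital has visibly exceeded 2, half of it is withdrawn from play;
  one unit of the withdrawn half is saved for good and the excess is bet according to Lebesgue measure.
  The saved amount is then a lower bound of the capital that never decreases.\<close>
locale savings =
  fixes \<nu> K :: "(nat \<Rightarrow> bool) measure" and v w :: "nat \<Rightarrow> nat"
  assumes \<nu>: "computable_measure \<nu>" and K: "computable_measure K"
    and v: "computable v"
    and v_approx: "\<And>c n. \<bar>real (v (pair c n)) - 2 ^ n * measure \<nu> (cyl (bl_decode c))\<bar> \<le> 2"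
    and w: "computable w"
    and w_approx: "\<And>c n. \<bar>real (w (pair c n)) - 2 ^ n * (measure K (cyl (bl_decode c)) + 1 / 2 ^ code_len c)\<bar> \<le> 2"
begin

definition V :: "(nat \<Rightarrow> bool) \<Rightarrow> nat \<Rightarrow> real" where
  "V X n = measure \<nu> (cyl (pre X n))"

definition W :: "(nat \<Rightarrow> bool) \<Rightarrow> nat \<Rightarrow> real" where
  "W X n = measure K (cyl (pre X n)) + 1 / 2 ^ n"

text \<open>A decidable substitute for the comparison of W with 2^(j + 1) V. The added twos make it
  sound. The precision is tied to the length of the string because W is at least 2^-length, so that
  2^N W is at least 2^(j + 5) and outweighs the approximation errors.\<close>

definition exceeds :: "nat \<Rightarrow> nat \<Rightarrow> bool" where
  "exceeds j c \<longleftrightarrow> (let N = code_len c + j + 5 in 2 ^ Suc j * (v (pair c N) + 2) + 2 \<le> w (pair c N))"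

definition saved :: "(nat \<Rightarrow> bool) \<Rightarrow> nat \<Rightarrow> nat" where
  "saved X n = rec_nat 0 (\<lambda>i j. j + of_bool (exceeds j (bl_code (pre X (Suc i))))) n"

definition saves :: "(nat \<Rightarrow> bool) \<Rightarrow> nat \<Rightarrow> bool" where
  "saves X n \<longleftrightarrow> exceeds (saved X n) (bl_code (pre X (Suc n)))"

text \<open>A saving at step i withdraws W / 2^(j + 1), where j is the number of earlier savings.
  One unit of capital, which in terms of measures is V, is saved for good; the rest is halved with
  every later bit. By \<open>saves_imp\<close> the \<open>max 0\<close> does not alter the value,
  and it matches \<open>computable_reals_diff\<close>.\<close>

definition excess :: "(nat \<Rightarrow> bool) \<Rightarrow> nat \<Rightarrow> real" where
  "excess X n = (\<Sum>i<n. real (of_bool (saves X i)) * (max 0 (W X (Suc i) / 2 ^ Suc (saved X i) - V X (Suc i))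
     / 2 ^ (n - Suc i)))"

text \<open>The whole capital multiplied by the \<nu>-measure of the cylinder. Working with this
  additive set function in place of the martingale avoids dividing by V, which may vanish.\<close>

definition total :: "(nat \<Rightarrow> bool) \<Rightarrow> nat \<Rightarrow> real" where
  "total X n = real (saved X n) * V X n + W X n / 2 ^ saved X n + excess X n"

lemma saved_0 [simp]: "saved X 0 = 0"
  by (simp add: saved_def)

lemma saved_Suc: "saved X (Suc n) = saved X n + of_bool (saves X n)"
  by (simp add: saved_def saves_def)

lemma saved_mono: "m \<le> n \<Longrightarrow> saved X m \<le> saved X n"
  by (induction rule: dec_induct) (auto simp: saved_Suc)

lemma saved_cong: "pre X n = pre Y n \<Longrightarrow> saved X n = saved Y n"
proof (induction n)
  case (Suc n)
  then have "saved X n = saved Y n" by (simp add: pre_Suc)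
  then show ?case using Suc.prems by (simp add: saved_Suc saves_def)
qed simp

lemma saves_cong: "pre X n = pre Y n \<Longrightarrow> i < n \<Longrightarrow> saves X i = saves Y i"
  unfolding saves_def using pre_eq_mono[of X n Y i] pre_eq_mono[of X n Y "Suc i"] saved_cong[of X i Y]
  by simp

lemma V_cong: "pre X n = pre Y n \<Longrightarrow> i \<le> n \<Longrightarrow> V X i = V Y i"
  using pre_eq_mono[of X n Y i] by (simp add: V_def)

lemma W_cong: "pre X n = pre Y n \<Longrightarrow> i \<le> n \<Longrightarrow> W X i = W Y i"
  using pre_eq_mono[of X n Y i] by (simp add: W_def)

lemma excess_cong:
  assumes "pre X n = pre Y n" shows "excess X n = excess Y n"
  unfolding excess_def
proof (rule sum.cong[OF refl])
  fix i assume "i \<in> {..<n}"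
  then have i: "i < n" "Suc i \<le> n" "i \<le> n" by auto
  show "real (of_bool (saves X i)) * (max 0 (W X (Suc i) / 2 ^ Suc (saved X i) - V X (Suc i)) / 2 ^ (n - Suc i))
    = real (of_bool (saves Y i)) * (max 0 (W Y (Suc i) / 2 ^ Suc (saved Y i) - V Y (Suc i)) / 2 ^ (n - Suc i))"
    using saves_cong[OF assms i(1)] V_cong[OF assms i(2)] W_cong[OF assms i(2)]
      saved_cong[OF pre_eq_mono[OF assms i(3)]] by simp
qed

lemma total_cong: "pre X n = pre Y n \<Longrightarrow> total X n = total Y n"
  unfolding total_def using saved_cong[of X n Y] V_cong[of X n Y n] W_cong[of X n Y n] excess_cong[of X n Y] by simp

lemma V_nonneg: "0 \<le> V X n" and W_pos: "1 / 2 ^ n \<le> W X n"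
  by (simp_all add: V_def W_def)

lemma W_nonneg: "0 \<le> W X n"
  by (simp add: W_def)

lemma excess_nonneg: "0 \<le> excess X n"
  unfolding excess_def by (intro sum_nonneg) auto

lemma total_nonneg: "0 \<le> total X n" and saved_le_total: "real (saved X n) * V X n \<le> total X n"
  unfolding total_def using V_nonneg[of X n] W_nonneg[of X n] excess_nonneg[of X n] by (auto intro!: add_nonneg_nonneg)

lemma saves_imp: "saves X n \<Longrightarrow> 2 ^ Suc (saved X n) * V X (Suc n) \<le> W X (Suc n)"
proof -
  assume s: "saves X n"
  define c where "c = bl_code (pre X (Suc n))"
  define N where "N = code_len c + saved X n + 5"
  have "2 ^ Suc (saved X n) * (v (pair c N) + 2) + 2 \<le> w (pair c N)"
    using s by (simp add: saves_def exceeds_def c_def N_def Let_def)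
  then have "2 ^ Suc (saved X n) * (real (v (pair c N)) + 2) + 2 \<le> real (w (pair c N))"
    by (simp add: algebra_simps flip: of_nat_le_iff[where 'a=real])
  moreover have "2 ^ Suc (saved X n) * (2 ^ N * V X (Suc n)) \<le> 2 ^ Suc (saved X n) * (real (v (pair c N)) + 2)"
    using v_approx[of c N] by (intro mult_left_mono) (auto simp: c_def V_def)
  moreover have "real (w (pair c N)) \<le> 2 ^ N * W X (Suc n) + 2"
    using w_approx[of c N] by (auto simp: c_def W_def)
  ultimately have "2 ^ Suc (saved X n) * (2 ^ N * V X (Suc n)) \<le> 2 ^ N * W X (Suc n)" by linarith
  then have "2 ^ N * (2 ^ Suc (saved X n) * V X (Suc n)) \<le> 2 ^ N * W X (Suc n)"
    by (metis mult.left_commute)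
  then show ?thesis by (rule mult_left_le_imp_le) simp
qed

text \<open>With j savings so far, failure of the test gives 2^N W at most 2^(j + 1) 2^N V plus
  errors 4 * 2^(j + 1) + 4. These errors are at most half of 2^N W, since 2^N W \<ge> 32 * 2^j;
  absorbing them costs one factor of 2.\<close>

lemma not_saves_imp: "\<not> saves X n \<Longrightarrow> W X (Suc n) \<le> 2 ^ (saved X n + 2) * V X (Suc n)"
proof -
  assume s: "\<not> saves X n"
  define c where "c = bl_code (pre X (Suc n))"
  define j where "j = saved X n"
  define N where "N = code_len c + j + 5"
  have "w (pair c N) < 2 ^ Suc j * (v (pair c N) + 2) + 2"
    using s by (simp add: saves_def exceeds_def c_def N_def j_def Let_def)
  then have "real (w (pair c N)) < 2 ^ Suc j * (real (v (pair c N)) + 2) + 2"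
    by (simp add: algebra_simps flip: of_nat_less_iff[where 'a=real])
  moreover have "2 ^ Suc j * (real (v (pair c N)) + 2) \<le> 2 ^ Suc j * (2 ^ N * V X (Suc n) + 4)"
    using v_approx[of c N] by (intro mult_left_mono) (auto simp: c_def V_def)
  moreover have "2 ^ N * W X (Suc n) \<le> real (w (pair c N)) + 2"
    using w_approx[of c N] by (auto simp: c_def W_def)
  ultimately have a: "2 ^ N * W X (Suc n) \<le> 2 ^ Suc j * (2 ^ N * V X (Suc n)) + 2 ^ Suc j * 4 + 4"
    by (simp add: distrib_left)
  have "2 ^ j * 32 = (2::real) ^ N * (1 / 2 ^ Suc n)"
    by (simp add: N_def c_def power_add)
  also have "\<dots> \<le> 2 ^ N * W X (Suc n)"
    by (intro mult_left_mono W_pos) simp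
  finally have "2 ^ j * 32 \<le> 2 ^ N * W X (Suc n)" .
  moreover have "1 \<le> (2::real) ^ j" by simp
  moreover have "2 * (2 * q * 4 + 4) \<le> x" if "q * 32 \<le> x" "1 \<le> q" for q x :: real
    using that by (auto simp: algebra_simps)
  ultimately have b: "2 * (2 ^ Suc j * 4 + 4) \<le> 2 ^ N * W X (Suc n)"
    unfolding power_Suc by blast
  have "2 ^ N * W X (Suc n) \<le> 2 * (2 ^ Suc j * (2 ^ N * V X (Suc n)))"
  proof -
    have "x \<le> 2 * y" if "x \<le> y + p * 4 + 4" "2 * (p * 4 + 4) \<le> x" for x y p :: real
      using that by (auto simp: algebra_simps)
    from this[OF a b] show ?thesis .
  qed
  also have "\<dots> = 2 ^ N * (2 ^ (j + 2) * V X (Suc n))" by (simp add: power_add)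
  finally show ?thesis unfolding j_def by (rule mult_left_le_imp_le) simp
qed

lemma excess_Suc:
  "excess X (Suc n) = excess X n / 2
    + of_bool (saves X n) * (W X (Suc n) / 2 ^ Suc (saved X n) - V X (Suc n))"
proof -
  have "(\<Sum>i<n. real (of_bool (saves X i)) * (max 0 (W X (Suc i) / 2 ^ Suc (saved X i) - V X (Suc i)) / 2 ^ (Suc n - Suc i)))
    = excess X n / 2"
    unfolding excess_def sum_divide_distrib
  proof (rule sum.cong[OF refl])
    fix i assume "i \<in> {..<n}"
    then have "Suc n - Suc i = Suc (n - Suc i)" by auto
    then show "real (of_bool (saves X i)) * (max 0 (W X (Suc i) / 2 ^ Suc (saved X i) - V X (Suc i)) / 2 ^ (Suc n - Suc i))
      = real (of_bool (saves X i)) * (max 0 (W X (Suc i) / 2 ^ Suc (saved X i) - V X (Suc i)) / 2 ^ (n - Suc i)) / 2"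
      by (simp only: power_Suc) simp
  qed
  moreover have "0 \<le> W X (Suc n) / 2 ^ Suc (saved X n) - V X (Suc n)" if "saves X n"
    using saves_imp[OF that] by (simp add: field_simps)
  ultimately show ?thesis
    by (cases "saves X n") (simp_all add: excess_def max_absorb2)
qed

text \<open>A saving only moves capital between the three parts, so the new total has the same form
  whether or not one takes place. Being expressed with the old number of savings, it makes
  additivity immediate: V and W are additive and the excess is split into halves.\<close>

lemma total_Suc: "total X (Suc n) = real (saved X n) * V X (Suc n) + W X (Suc n) / 2 ^ saved X n + excess X n / 2"
proof (cases "saves X n")
  case True
  then have "total X (Suc n) = (real (saved X n) + 1) * V X (Suc n) + W X (Suc n) / 2 ^ Suc (saved X n)
    + (excess X n / 2 + (W X (Suc n) / 2 ^ Suc (saved X n) - V X (Suc n)))"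
    by (simp add: total_def saved_Suc excess_Suc)
  moreover have "W X (Suc n) / 2 ^ Suc (saved X n) = (W X (Suc n) / 2 ^ saved X n) / 2" by simp
  moreover have "t = i * x + y + e / 2" if "t = (i + 1) * x + h + (e / 2 + (h - x))" "h = y / 2"
    for t i x y e h :: real
    using that by (simp add: algebra_simps)
  ultimately show ?thesis by blast
next
  case False
  then show ?thesis by (simp add: total_def saved_Suc excess_Suc)
qed

lemma V_split: "V X n = V (X(n := False)) (Suc n) + V (X(n := True)) (Suc n)"
proof -
  have "pre (X(n := b)) (Suc n) = pre X n @ [b]" for b by (simp add: pre_Suc) (simp add: pre_def)
  then show ?thesis
    using \<nu> measure_cyl_split[of \<nu> "pre X n"] by (simp add: V_def computable_measure_def)
qed

lemma W_split: "W X n = W (X(n := False)) (Suc n) + W (X(n := True)) (Suc n)"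
proof -
  have "pre (X(n := b)) (Suc n) = pre X n @ [b]" for b by (simp add: pre_Suc) (simp add: pre_def)
  then show ?thesis
    using K measure_cyl_split[of K "pre X n"] by (simp add: W_def computable_measure_def)
qed

lemma total_split: "total X n = total (X(n := False)) (Suc n) + total (X(n := True)) (Suc n)"
proof -
  have p: "pre (X(n := b)) n = pre X n" for b by (simp add: pre_eq_iff)
  show ?thesis
    unfolding total_Suc saved_cong[OF p] excess_cong[OF p]
    unfolding total_def V_split[of X n] W_split[of X n] by (simp add: algebra_simps add_divide_distrib)
qed

lemma computable_exceeds [cintro]:
  "computable f \<Longrightarrow> computable g \<Longrightarrow> computable (\<lambda>x. of_bool (exceeds (f x) (g x)))"
  unfolding exceeds_def Let_def
  by (intro cintro computable_comp[OF v] computable_comp[OF w])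

lemma computable_saved:
  assumes b: "computable (\<lambda>z. of_bool (b (pfst z) (psnd z)))" and n: "computable n"
  shows "computable (\<lambda>x. saved (b x) (n x))"
  unfolding saved_def
  by (intro cintro n computable_comp_pair[of "\<lambda>x y. of_bool (b x y)", OF b])

lemma computable_saves:
  assumes b: "computable (\<lambda>z. of_bool (b (pfst z) (psnd z)))" and n: "computable n"
  shows "computable (\<lambda>x. of_bool (saves (b x) (n x)))"
  unfolding saves_def
  by (intro cintro n computable_saved b)

lemma computable_V:
  assumes b: "computable (\<lambda>z. of_bool (b (pfst z) (psnd z)))" and n: "computable n"
  shows "computable_reals (\<lambda>x. V (b x) (n x))"
  unfolding V_def by (rule computable_measure_pre[OF \<nu> assms])

lemma computable_W:
  assumes b: "computable (\<lambda>z. of_bool (b (pfst z) (psnd z)))" and n: "computable n"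
  shows "computable_reals (\<lambda>x. W (b x) (n x))"
proof -
  have "computable_reals (\<lambda>x. real 1 / 2 ^ n x)"
    by (intro computable_reals_div_power computable_reals_of_nat n computable_const)
  then show ?thesis
    unfolding W_def using computable_reals_add[OF computable_measure_pre[OF K assms]] by simp
qed

lemma computable_total:
  assumes b: "computable (\<lambda>z. of_bool (b (pfst z) (psnd z)))" and n: "computable n"
  shows "computable_reals (\<lambda>x. total (b x) (n x))"
  unfolding total_def excess_def
  by (intro computable_reals_add computable_reals_mult_nat computable_reals_sum computable_reals_diff
      computable_reals_div_power computable_V computable_W computable_saved computable_saves cintro b n
      computable_comp[OF n] computable_comp_pair[of "\<lambda>x y. of_bool (b x y)", OF b])

section \<open>The savings as a randomness test\<close>

definition saving_test :: "(nat \<Rightarrow> bool) \<Rightarrow> ennreal" where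
  "saving_test X = (SUP n. ennreal (real (saved X n)))"

lemma lower_semicomputable_saving_test: "lower_semicomputable saving_test"
proof -
  let ?g = "\<lambda>z. saved (bit (pfst z)) (psnd z)"
  \<comment> \<open>The enumeration runs over all pairs of a prefix, given as i and a length, and
    the amount saved along it; \<open>pair 0 (pair k 0)\<close> is the code of the rational k /
    1.\<close>
  let ?f = "\<lambda>z. pair (bl_code (pre (bit (pfst z)) (psnd z))) (pair 0 (pair (?g z) 0))"
  have "computable ?f"
    by (intro cintro computable_saved)
  moreover have "saving_test X = (SUP n. case prod_decode (?f n) of (s, r) \<Rightarrow>
              (if X \<in> cyl (bl_decode s) then ennreal (rat_decode r) else 0))" for X
  proof -
    have f: "(case prod_decode (?f n) of (s, r) \<Rightarrow>
              (if X \<in> cyl (bl_decode s) then ennreal (rat_decode r) else 0))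
      = (if pre X (psnd n) = pre (bit (pfst n)) (psnd n) then ennreal (real (?g n)) else 0)" for n
      by (simp add: mem_cyl_iff rat_decode_def)
    show ?thesis
      unfolding f saving_test_def
    proof (intro antisym SUP_least)
      fix n
      obtain i where "pre X n = pre (bit (i::nat)) n" using pre_bit_exists by blast
      then show "ennreal (real (saved X n)) \<le>
          (SUP n. if pre X (psnd n) = pre (bit (pfst n)) (psnd n) then ennreal (real (?g n)) else 0)"
        using saved_cong[of X n "bit i"] by (intro SUP_upper2[of "pair i n"]) auto
    next
      fix n
      show "(if pre X (psnd n) = pre (bit (pfst n)) (psnd n) then ennreal (real (?g n)) else 0)
        \<le> (SUP n. ennreal (real (saved X n)))"
        using saved_cong[of X "psnd n" "bit (pfst n)"]
        by (auto intro!: SUP_upper2[of "psnd n"])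
    qed
  qed
  ultimately show ?thesis
    unfolding lower_semicomputable_def by blast
qed

lemma saved_measurable [measurable]: "(\<lambda>X. ennreal (real (saved X n))) \<in> borel_measurable cantor"
proof -
  define g where "g \<sigma> = ennreal (real (saved (\<lambda>i. if i < n then \<sigma> ! i else False) n))" for \<sigma>
  have "ennreal (real (saved X n)) = g (pre X n)" for X
    using saved_cong[of X n "\<lambda>i. if i < n then pre X n ! i else False"] by (simp add: g_def pre_eq_iff)
  then show ?thesis by (simp only: fun_pre_measurable)
qed

text \<open>At depth n + d the amount saved, weighted by V, is at most the total, and the total is
  additive; the bound is passed up the binary tree one level at a time.\<close>

lemma saved_integral_le:
  "set_nn_integral \<nu> (cyl (pre X n)) (\<lambda>Z. ennreal (real (saved Z (n + d)))) \<le> ennreal (total X n)"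
proof (induction d arbitrary: X n)
  case 0
  interpret finite_measure \<nu> using \<nu> by (simp add: computable_measure_def)
  have [measurable_cong]: "sets \<nu> = sets cantor" using \<nu> by (simp add: computable_measure_def)
  have "set_nn_integral \<nu> (cyl (pre X n)) (\<lambda>Z. ennreal (real (saved Z n)))
    = set_nn_integral \<nu> (cyl (pre X n)) (\<lambda>Z. ennreal (real (saved X n)))"
    by (rule nn_integral_cong) (auto simp: indicator_def mem_cyl_pre dest: saved_cong)
  also have "\<dots> = ennreal (real (saved X n)) * emeasure \<nu> (cyl (pre X n))"
    by (rule nn_integral_cmult_indicator) measurable
  also have "\<dots> = ennreal (real (saved X n) * V X n)"
    by (simp add: emeasure_eq_measure V_def ennreal_mult)
  also have "\<dots> \<le> ennreal (total X n)" by (rule ennreal_leI[OF saved_le_total])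
  finally show ?case by simp
next
  case (Suc d)
  have M [measurable_cong]: "sets \<nu> = sets cantor" using \<nu> by (simp add: computable_measure_def)
  have p: "pre X n @ [b] = pre (X(n := b)) (Suc n)" for b by (simp add: pre_Suc) (simp add: pre_def)
  have "set_nn_integral \<nu> (cyl (pre X n)) (\<lambda>Z. ennreal (real (saved Z (n + Suc d))))
    = set_nn_integral \<nu> (cyl (pre X n @ [False])) (\<lambda>Z. ennreal (real (saved Z (Suc n + d))))
    + set_nn_integral \<nu> (cyl (pre X n @ [True])) (\<lambda>Z. ennreal (real (saved Z (Suc n + d))))"
    unfolding cyl_split[of "pre X n"] add_Suc_right add_Suc
  proof (rule nn_integral_disjoint_pair)
    show "(\<lambda>Z. ennreal (real (saved Z (Suc (n + d))))) \<in> borel_measurable \<nu>"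
      unfolding measurable_cong_sets[OF M refl] by (rule saved_measurable)
  qed (unfold M, (rule cyl_measurable cyl_split_disjoint)+)
  also have "\<dots> \<le> ennreal (total (X(n := False)) (Suc n)) + ennreal (total (X(n := True)) (Suc n))"
    unfolding p by (intro add_mono Suc.IH)
  also have "\<dots> = ennreal (total X n)"
    unfolding total_split[of X n] by (simp add: total_nonneg)
  finally show ?case .
qed

text \<open>Savings never decrease, so the supremum may start at depth n and monotone convergence
  applies. An unsaved capital, which may fall again, would not allow this exchange.\<close>

lemma saving_test_integral_le: "set_nn_integral \<nu> (cyl (pre X n)) saving_test \<le> ennreal (total X n)"
proof -
  have M [measurable_cong]: "sets \<nu> = sets cantor" using \<nu> by (simp add: computable_measure_def)
  have eq: "saving_test Z = (SUP d. ennreal (real (saved Z (n + d))))" for Z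
    unfolding saving_test_def
  proof (intro antisym SUP_least)
    fix i show "ennreal (real (saved Z i)) \<le> (SUP d. ennreal (real (saved Z (n + d))))"
      by (rule SUP_upper2[of i]) (auto intro!: ennreal_leI saved_mono)
  next
    fix i show "ennreal (real (saved Z (n + i))) \<le> (SUP n. ennreal (real (saved Z n)))"
      by (rule SUP_upper2[of "n + i"]) auto
  qed
  have "set_nn_integral \<nu> (cyl (pre X n)) saving_test
    = (\<integral>\<^sup>+Z. (SUP d. ennreal (real (saved Z (n + d))) * indicator (cyl (pre X n)) Z) \<partial>\<nu>)"
    unfolding eq by (rule nn_integral_cong) (simp add: SUP_mult_right_ennreal)
  also have "\<dots> = (SUP d. set_nn_integral \<nu> (cyl (pre X n)) (\<lambda>Z. ennreal (real (saved Z (n + d)))))"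
  proof (rule nn_integral_monotone_convergence_SUP)
    show "incseq (\<lambda>d Z. ennreal (real (saved Z (n + d))) * indicator (cyl (pre X n)) Z)"
      by (auto simp: incseq_def le_fun_def intro!: mult_right_mono ennreal_leI saved_mono)
    show "(\<lambda>Z. ennreal (real (saved Z (n + d))) * indicator (cyl (pre X n)) Z) \<in> borel_measurable \<nu>" for d
      unfolding measurable_cong_sets[OF M refl]
      by (rule borel_measurable_times_ennreal[OF saved_measurable borel_measurable_indicator[OF cyl_measurable]])
  qed
  also have "\<dots> \<le> ennreal (total X n)" by (rule SUP_least) (rule saved_integral_le)
  finally show ?thesis .
qed

lemma total_measure: "\<exists>\<kappa>. computable_measure \<kappa> \<and> (\<forall>X n. emeasure \<kappa> (cyl (pre X n)) = ennreal (total X n))"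
proof -
  define m where "m \<sigma> = total (code_bit (bl_code \<sigma>)) (length \<sigma>)" for \<sigma>
  have m: "m (pre X n) = total X n" for X n
    unfolding m_def length_pre by (rule total_cong) (use pre_code_bit_bl_code[of "pre X n"] in simp)
  have add: "m \<sigma> = m (\<sigma> @ [False]) + m (\<sigma> @ [True])" for \<sigma>
  proof -
    define X where "X = code_bit (bl_code \<sigma>)"
    have \<sigma>: "\<sigma> = pre X (length \<sigma>)" by (simp add: X_def)
    have "pre X n @ [b] = pre (X(n := b)) (Suc n)" for b n by (simp add: pre_Suc) (simp add: pre_def)
    then show ?thesis by (subst (1 2 3) \<sigma>) (simp only: m total_split[of X "length \<sigma>"])
  qed
  obtain \<kappa> where \<kappa>: "sets \<kappa> = sets cantor" "finite_measure \<kappa>" "\<And>\<sigma>. measure \<kappa> (cyl \<sigma>) = m \<sigma>"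
    using measure_extension[of m] add by (auto simp: m_def total_nonneg)
  have "computable_measure \<kappa>"
  proof (rule computable_measureI[OF \<kappa>(1,2)])
    show "computable_reals (\<lambda>c. measure \<kappa> (cyl (bl_decode c)))"
      unfolding \<kappa>(3) bl_decode_eq_pre m by (intro computable_total cintro)
  qed
  moreover have "emeasure \<kappa> (cyl (pre X n)) = ennreal (total X n)" for X n
    using finite_measure.emeasure_eq_measure[OF \<kappa>(2)] by (simp add: \<kappa>(3) m)
  ultimately show ?thesis by blast
qed

text \<open>Randomness makes the savings along Z bounded, hence eventually constant at some j. From
  then on no saving is triggered, and \<open>not_saves_imp\<close> bounds W by 2^(j + 2) V.\<close>

lemma random_imp_bounded:
  assumes Z: "computably_random \<nu> Z"
  shows "\<exists>C>0. \<forall>n. measure K (cyl (pre Z n)) + 1 / 2 ^ n \<le> C * measure \<nu> (cyl (pre Z n))"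
proof -
  obtain \<kappa> where \<kappa>: "computable_measure \<kappa>" "\<And>X n. emeasure \<kappa> (cyl (pre X n)) = ennreal (total X n)"
    using total_measure by blast
  have "set_nn_integral \<nu> (cyl \<sigma>) saving_test \<le> emeasure \<kappa> (cyl \<sigma>)" for \<sigma>
    using saving_test_integral_le[of "code_bit (bl_code \<sigma>)" "length \<sigma>"]
      \<kappa>(2)[of "code_bit (bl_code \<sigma>)" "length \<sigma>"] by simp
  with Z \<kappa>(1) lower_semicomputable_saving_test have "saving_test Z < \<infinity>"
    by (auto simp: computably_random_def)
  then obtain B where B: "saving_test Z = ennreal B" "0 \<le> B" by (cases "saving_test Z") auto
  have "saved Z n \<le> nat \<lceil>B\<rceil>" for n
  proof -
    have "ennreal (real (saved Z n)) \<le> ennreal B"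
      unfolding B(1)[symmetric] saving_test_def by (rule SUP_upper) simp
    then have "real (saved Z n) \<le> B" using ennreal_le_iff[OF B(2)] by blast
    also have "B \<le> real (nat \<lceil>B\<rceil>)" by (rule real_nat_ceiling_ge)
    finally show ?thesis by (simp only: of_nat_le_iff)
  qed
  then have fin: "finite (range (saved Z))"
    by (intro finite_subset[OF image_subsetI finite_atMost]) (rule atMost_iff[THEN iffD2])
  define j where "j = Max (range (saved Z))"
  have "j \<in> range (saved Z)" unfolding j_def by (rule Max_in[OF fin]) auto
  then obtain n0 where n0: "saved Z n0 = j" by auto
  have const: "saved Z n = j" if "n0 \<le> n" for n
    using saved_mono[OF that, of Z] Max_ge[OF fin, of "saved Z n"] n0 by (simp add: j_def)
  have late: "W Z n \<le> 2 ^ (j + 2) * V Z n" if n: "Suc n0 \<le> n" for n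
  proof -
    obtain k where k: "n = Suc k" "n0 \<le> k" using n by (cases n) auto
    then have "\<not> saves Z k" using const[of k] const[of "Suc k"] by (auto simp: saved_Suc)
    from not_saves_imp[OF this] show ?thesis using k const[of k] by simp
  qed
  interpret \<nu>: finite_measure \<nu> using \<nu> by (simp add: computable_measure_def)
  interpret K: finite_measure K using K by (simp add: computable_measure_def)
  have [simp]: "sets \<nu> = sets cantor" "sets K = sets cantor" using \<nu> K by (simp_all add: computable_measure_def)
  define n1 where "n1 = Suc n0"
  have "0 < 1 / (2::real) ^ n1" by simp
  also have "\<dots> \<le> W Z n1" by (rule W_pos)
  also have "\<dots> \<le> 2 ^ (j + 2) * V Z n1" by (rule late) (simp add: n1_def)
  finally have pos: "0 < V Z n1" by (simp add: zero_less_mult_iff)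
  \<comment> \<open>This constant serves the finitely many n below n1: V at n1 is positive because W
    is, and V does not increase along Z.\<close>
  define A where "A = (measure K (space K) + 1) / V Z n1"
  have A: "0 \<le> A" using pos by (simp add: A_def)
  show ?thesis
  proof (intro exI[of _ "2 ^ (j + 2) + A"] conjI allI)
    show "0 < 2 ^ (j + 2) + A" using A by (intro add_pos_nonneg) auto
    fix n
    show "measure K (cyl (pre Z n)) + 1 / 2 ^ n \<le> (2 ^ (j + 2) + A) * measure \<nu> (cyl (pre Z n))"
    proof (cases "n1 \<le> n")
      case True
      have "measure K (cyl (pre Z n)) + 1 / 2 ^ n = W Z n" by (simp add: W_def)
      also have "\<dots> \<le> 2 ^ (j + 2) * V Z n" using late True by (simp add: n1_def)
      also have "\<dots> \<le> (2 ^ (j + 2) + A) * V Z n" using A V_nonneg by (intro mult_right_mono) auto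
      finally show ?thesis by (simp add: V_def)
    next
      case False
      have "cyl (pre Z n1) \<subseteq> cyl (pre Z n)" using False by (auto simp: mem_cyl_pre pre_eq_iff)
      then have "V Z n1 \<le> V Z n" unfolding V_def by (intro \<nu>.finite_measure_mono) auto
      have "measure K (cyl (pre Z n)) + 1 / 2 ^ n \<le> measure K (space K) + 1"
        by (intro add_mono K.bounded_measure) simp
      also have "\<dots> = A * V Z n1" using pos by (simp add: A_def)
      also have "\<dots> \<le> (2 ^ (j + 2) + A) * V Z n"
        using A pos \<open>V Z n1 \<le> V Z n\<close> by (intro mult_mono) auto
      finally show ?thesis by (simp add: V_def)
    qed
  qed
qed

end

text \<open>The summand 1 / 2^n, coming from Lebesgue measure, is kept in the conclusion because it
  also shows that \<nu> is positive on all cylinders around Z.\<close>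

lemma computably_random_ratio_bounded:
  assumes \<nu>: "computable_measure \<nu>" and K: "computable_measure K" and Z: "computably_random \<nu> Z"
  shows "\<exists>C>0. \<forall>n. measure K (cyl (pre Z n)) + 1 / 2 ^ n \<le> C * measure \<nu> (cyl (pre Z n))"
proof -
  obtain v where v: "computable v" "\<And>c n. \<bar>real (v (pair c n)) - 2 ^ n * measure \<nu> (cyl (bl_decode c))\<bar> \<le> 2"
    by (rule computable_measure_approx[OF \<nu>]) (rule that)
  have "computable_reals (\<lambda>c. measure K (cyl (bl_decode c)) + real 1 / 2 ^ code_len c)"
    by (intro computable_reals_add computable_reals_div_power computable_reals_of_nat
        computable_measure_reals[OF K] cintro)
  then obtain w where w: "computable w"
    "\<And>c n. \<bar>real (w (pair c n)) - 2 ^ n * (measure K (cyl (bl_decode c)) + 1 / 2 ^ code_len c)\<bar> \<le> 2"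
    by (auto simp: computable_reals_def)
  interpret savings \<nu> K v w by unfold_locales (fact \<nu> K v w)+
  show ?thesis by (rule random_imp_bounded[OF Z])
qed

subsection \<open>Almost everywhere computable maps\<close>

lemma computable_reals_event:
  assumes M: "computable_measure M"
    and P: "\<And>a X Y. pre X (l a) = pre Y (l a) \<Longrightarrow> P a X = P a Y"
    and c: "computable (\<lambda>z. of_bool (P (pfst z) (bit (psnd z))))" "computable l"
  shows "computable_reals (\<lambda>a. measure M {X. P a X})"
proof -
  have M': "sets M = sets cantor" "finite_measure M" using M by (auto simp: computable_measure_def)
  have "{X. P a X} \<in> sets M" for a
  proof -
    define g where "g \<sigma> = P a (\<lambda>i. if i < l a then \<sigma> ! i else False)" for \<sigma>
    have "P a X = g (pre X (l a))" for X unfolding g_def by (rule P) (simp add: pre_eq_iff)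
    then show ?thesis using pred_pre_measurable[of g "l a"] by (simp add: M'(1) pred_def)
  qed
  then have "measure M {X. P a X} = enn2real (\<integral>\<^sup>+X. of_nat (of_bool (P a X)) \<partial>M)" for a
  proof -
    have "(\<integral>\<^sup>+X. of_nat (of_bool (P a X)) \<partial>M) = (\<integral>\<^sup>+X. indicator {X. P a X} X \<partial>M)"
      by (rule nn_integral_cong) (simp add: indicator_def)
    then show ?thesis using \<open>{X. P a X} \<in> sets M\<close> by (simp add: measure_def)
  qed
  moreover have "computable_reals (\<lambda>a. enn2real (\<integral>\<^sup>+X. of_nat (of_bool (P a X)) \<partial>M))"
    by (intro computable_reals_integral[where l = l] M c arg_cong[where f = of_bool] P)
  ultimately show ?thesis by simp
qed

lemma prefix_pre: "m \<le> n \<Longrightarrow> prefix (pre X m) (pre X n)"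
  using take_is_prefix[of m "pre X n"] by (simp add: take_pre min_absorb1)

lemma prefix_nth: "prefix \<sigma> \<tau> \<Longrightarrow> i < length \<sigma> \<Longrightarrow> \<tau> ! i = \<sigma> ! i"
  by (auto simp: prefix_def nth_append)

locale computable_map =
  fixes \<mu> :: "(nat \<Rightarrow> bool) measure" and T :: "(nat \<Rightarrow> bool) \<Rightarrow> (nat \<Rightarrow> bool) option"
    and \<phi> :: "bool list \<Rightarrow> bool list" and f :: "nat \<Rightarrow> nat"
  assumes \<mu>: "computable_measure \<mu>" and prob: "prob_space \<mu>"
    and f: "computable f" and f_bl_code: "\<And>\<sigma>. f (bl_code \<sigma>) = bl_code (\<phi> \<sigma>)"
    and mono: "\<And>\<sigma> \<tau>. prefix \<sigma> \<tau> \<Longrightarrow> prefix (\<phi> \<sigma>) (\<phi> \<tau>)"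
    and T_iff: "\<And>X Y. T X = Some Y \<longleftrightarrow> (\<forall>n. \<exists>m. prefix (pre Y n) (\<phi> (pre X m)))"
    and full: "measure \<mu> {X. T X \<noteq> None} = 1"
begin

sublocale prob_space \<mu> by (fact prob)

lemma sets_\<mu>: "sets \<mu> = sets cantor"
  using \<mu> by (simp add: computable_measure_def)

definition out :: "(nat \<Rightarrow> bool) \<Rightarrow> nat \<Rightarrow> bool list" where
  "out X m = \<phi> (pre X m)"

definition dom :: "(nat \<Rightarrow> bool) set" where
  "dom = {X. \<forall>n. \<exists>m. n < length (out X m)}"

text \<open>A total extension of T: bits that are never output are set to False. It is measurable on
  the whole space and agrees with T on \<open>dom\<close>, so preimages can be taken without
  options.\<close>

definition S :: "(nat \<Rightarrow> bool) \<Rightarrow> nat \<Rightarrow> bool" where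
  "S X n \<longleftrightarrow> (\<exists>m. n < length (out X m) \<and> out X m ! n)"

lemma out_cong: "pre X m = pre Z m \<Longrightarrow> out X m = out Z m"
  by (simp add: out_def)

lemma out_mono: "m \<le> n \<Longrightarrow> prefix (out X m) (out X n)"
  unfolding out_def by (intro mono prefix_pre)

lemma S_eq_nth: assumes "n < length (out X m)" shows "S X n = out X m ! n"
proof -
  have "out X k ! n = out X m ! n" if "n < length (out X k)" for k
    using prefix_nth[OF out_mono that, of m] prefix_nth[OF out_mono assms, of k] by (cases "k \<le> m") auto
  then show ?thesis using assms unfolding S_def by blast
qed

lemma pre_S: "l \<le> length (out X m) \<Longrightarrow> pre (S X) l = take l (out X m)"
  by (rule nth_equalityI) (auto simp: S_eq_nth)

lemma T_eq: "T X = (if X \<in> dom then Some (S X) else None)"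
proof (cases "X \<in> dom")
  case True
  have "\<exists>m. prefix (pre (S X) n) (\<phi> (pre X m))" for n
  proof -
    obtain m where "n < length (out X m)" using True by (auto simp: dom_def)
    then have "pre (S X) n = take n (out X m)" by (intro pre_S) simp
    then show ?thesis by (metis take_is_prefix out_def)
  qed
  then show ?thesis using True T_iff[of X "S X"] by simp
next
  case False
  have "T X \<noteq> Some Z" for Z
  proof
    assume "T X = Some Z"
    then have "\<exists>m. prefix (pre Z (Suc n)) (out X m)" for n by (simp add: T_iff out_def)
    then have "\<exists>m. n < length (out X m)" for n by (metis prefix_length_le length_pre Suc_le_eq)
    then show False using False by (simp add: dom_def)
  qed
  then show ?thesis using False by (cases "T X") auto
qed

lemma dom_sets [measurable]: "dom \<in> sets cantor"
proof -
  have "{X. n < length (out X m)} \<in> sets cantor" for n m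
    using pred_pre_measurable[of "\<lambda>\<sigma>. n < length (\<phi> \<sigma>)" m] by (simp add: out_def pred_def)
  then have "(\<Inter>n. \<Union>m. {X. n < length (out X m)}) \<in> sets cantor" by auto
  also have "(\<Inter>n. \<Union>m. {X. n < length (out X m)}) = dom" by (auto simp: dom_def)
  finally show ?thesis .
qed

lemma S_measurable: "S \<in> measurable cantor cantor"
proof (rule measurable_cantorI)
  fix n
  have "{X. n < length (out X m) \<and> out X m ! n} \<in> sets cantor" for m
    using pred_pre_measurable[of "\<lambda>\<sigma>. n < length (\<phi> \<sigma>) \<and> \<phi> \<sigma> ! n" m] by (simp add: out_def pred_def)
  then have "(\<Union>m. {X. n < length (out X m) \<and> out X m ! n}) \<in> sets cantor" by auto
  also have "(\<Union>m. {X. n < length (out X m) \<and> out X m ! n}) = {X \<in> space cantor. S X n}" by (auto simp: S_def)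
  finally show "Measurable.pred cantor (\<lambda>X. S X n)" by (simp add: pred_def)
qed

lemma vimage_S_sets: "S -` cyl \<sigma> \<in> sets cantor"
  using measurable_sets[OF S_measurable cyl_measurable] by simp

lemma AE_dom: "AE X in \<mu>. X \<in> dom"
proof -
  have "{X. T X \<noteq> None} = dom" by (auto simp: T_eq)
  then show ?thesis using full prob_eq_1[of dom] by (simp add: sets_\<mu>)
qed

lemma computable_out:
  assumes "computable (\<lambda>z. of_bool (b (pfst z) (psnd z)))" "computable n"
  shows "computable (\<lambda>x. bl_code (out (b x) (n x)))"
  unfolding out_def f_bl_code[symmetric] by (intro computable_comp[OF f] computable_pre assms)

lemma computable_short:
  assumes "computable (\<lambda>z. of_bool (b (pfst z) (psnd z)))" "computable n" "computable m"
  shows "computable (\<lambda>x. of_bool (length (out (b x) (m x)) \<le> n x))"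
  unfolding length_le_iff_code_drop by (intro cintro computable_out assms)

lemma short_sets: "{X. length (out X m) \<le> n} \<in> sets cantor"
  using pred_pre_measurable[of "\<lambda>\<sigma>. length (\<phi> \<sigma>) \<le> n" m] by (simp add: out_def pred_def)

text \<open>For fixed n these sets decrease in m, and their intersection misses the domain, hence is
  null.\<close>

lemma short_tendsto_0: "(\<lambda>m. measure \<mu> {X. length (out X m) \<le> n}) \<longlonglongrightarrow> 0"
proof -
  have lim: "(\<lambda>m. measure \<mu> {X. length (out X m) \<le> n}) \<longlonglongrightarrow> measure \<mu> (\<Inter>m. {X. length (out X m) \<le> n})"
  proof (rule finite_Lim_measure_decseq)
    show "range (\<lambda>m. {X. length (out X m) \<le> n}) \<subseteq> events" using short_sets by (auto simp: sets_\<mu>)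
    show "decseq (\<lambda>m. {X. length (out X m) \<le> n})"
      by (auto simp: decseq_def dest: out_mono[THEN prefix_length_le, THEN le_trans])
  qed
  have "(\<Inter>m. {X. length (out X m) \<le> n}) \<in> sets \<mu>" using short_sets by (auto simp: sets_\<mu>)
  moreover have "AE X in \<mu>. X \<notin> (\<Inter>m. {X. length (out X m) \<le> n})"
    using AE_dom by eventually_elim (auto simp: dom_def not_le)
  ultimately have "measure \<mu> (\<Inter>m. {X. length (out X m) \<le> n}) = 0"
    using prob_eq_0 by blast
  with lim show ?thesis by simp
qed

text \<open>The stage is found by searching for an approximation at precision 3 n + 3, i.e. in units
  of 1 / (8 * 8^n), that is at most 4. The search succeeds, since a measure below one unit is
  approximated by less than 4; an accepted stage has measure at most 6 units, less than 8 of
  them.\<close>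

lemma stages_exist: "\<exists>s. computable s \<and> (\<forall>n. measure \<mu> {X. length (out X (s n)) \<le> n} \<le> 1 / 8 ^ n)"
proof -
  have "computable_reals (\<lambda>a. measure \<mu> {X. length (out X (psnd a)) \<le> pfst a})"
  proof (rule computable_reals_event[OF \<mu>, where l = psnd])
    show "computable (\<lambda>z. of_bool (length (out (bit (psnd z)) (psnd (pfst z))) \<le> pfst (pfst z)))"
      by (intro computable_short cintro)
  qed (simp_all add: computable_prod_decode cong: out_cong)
  then obtain h where h: "computable h"
    "\<And>a N. \<bar>real (h (pair a N)) - 2 ^ N * measure \<mu> {X. length (out X (psnd a)) \<le> pfst a}\<bar> \<le> 2"
    by (auto simp: computable_reals_def)
  define q where "q n m = h (pair (pair n m) (3 * n + 3))" for n m
  have q: "\<bar>real (q n m) - 8 * 8 ^ n * measure \<mu> {X. length (out X m) \<le> n}\<bar> \<le> 2" for n m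
    using h(2)[of "pair n m" "3 * n + 3"] by (simp add: q_def power_add power_mult)
  have ex: "\<exists>m. q n m \<le> 4" for n
  proof -
    have "0 < 1 / (8 * 8 ^ n :: real)" by simp
    from order_tendstoD(2)[OF short_tendsto_0[of n] this]
    obtain m where "measure \<mu> {X. length (out X m) \<le> n} < 1 / (8 * 8 ^ n)" by (auto simp: eventually_sequentially)
    then have "8 * 8 ^ n * measure \<mu> {X. length (out X m) \<le> n} < 1" by (simp add: field_simps)
    then have "real (q n m) < 4" using q[of n m] by linarith
    then show ?thesis by (intro exI[of _ m]) linarith
  qed
  define s where "s n = (LEAST m. q n m \<le> 4)" for n
  have "q n (s n) \<le> 4" for n unfolding s_def by (rule LeastI_ex[OF ex])
  then have "real (q n (s n)) \<le> 4" for n using of_nat_mono[of "q n (s n)" 4] by simp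
  then have "8 * 8 ^ n * measure \<mu> {X. length (out X (s n)) \<le> n} \<le> 8" for n using q[of n "s n"] by (smt (verit))
  then have "measure \<mu> {X. length (out X (s n)) \<le> n} \<le> 1 / 8 ^ n" for n by (simp add: field_simps)
  moreover have "computable s"
    unfolding s_def q_def by (intro cintro computable_comp[OF h(1)] ex[unfolded q_def])
  ultimately show ?thesis by blast
qed

end

section \<open>Total approximations of the map and computable image measures\<close>

locale staged_map = computable_map +
  fixes s :: "nat \<Rightarrow> nat"
  assumes s: "computable s" and s_short: "\<And>n. measure \<mu> {X. length (out X (s n)) \<le> n} \<le> 1 / 8 ^ n"
begin

text \<open>The set E_n: at stage \<open>s n\<close> the bit with index n has not been
  output.\<close>

definition late :: "nat \<Rightarrow> (nat \<Rightarrow> bool) set" where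
  "late n = {X. length (out X (s n)) \<le> n}"

text \<open>This is T_k. Bit n is read at stage \<open>s (n + k)\<close> and set to False if absent,
  so it depends on a computable number of input bits for every X, also outside the domain of
  T.\<close>

definition total_map :: "nat \<Rightarrow> (nat \<Rightarrow> bool) \<Rightarrow> nat \<Rightarrow> bool" where
  "total_map k X n \<longleftrightarrow> n < length (out X (s (n + k))) \<and> out X (s (n + k)) ! n"

lemma late_sets [measurable]: "late n \<in> sets cantor"
  unfolding late_def by (rule short_sets)

lemma emeasure_late: "emeasure \<mu> (late n) \<le> ennreal (1 / 8 ^ n)"
  using s_short[of n] by (simp add: late_def emeasure_eq_measure ennreal_leI)

lemma total_map_eq: assumes "\<And>i. k \<le> i \<Longrightarrow> X \<notin> late i" shows "total_map k X = S X" "X \<in> dom"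
proof -
  have len: "n < length (out X (s (n + k)))" for n using assms[of "n + k"] by (simp add: late_def)
  then show "X \<in> dom" by (auto simp: dom_def)
  show "total_map k X = S X"
    by (rule ext) (simp add: total_map_def len S_eq_nth[OF len])
qed

text \<open>The sum of the stages serves as modulus: it dominates each of them, whether or not
  \<open>s\<close> is monotone, and is plainly computable.\<close>

lemma total_map_cong:
  assumes "pre X (\<Sum>i<n. s (i + k)) = pre Z (\<Sum>i<n. s (i + k))" shows "pre (total_map k X) n = pre (total_map k Z) n"
  unfolding pre_eq_iff
proof (intro allI impI)
  fix i assume "i < n"
  then have "s (i + k) \<le> (\<Sum>i<n. s (i + k))" by (intro member_le_sum) auto
  from out_cong[OF pre_eq_mono[OF assms this]] show "total_map k X i = total_map k Z i"
    by (simp add: total_map_def)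
qed

lemma total_map_measurable: "total_map k \<in> measurable cantor cantor"
proof (rule measurable_cantorI)
  fix n
  show "Measurable.pred cantor (\<lambda>X. total_map k X n)"
    unfolding total_map_def out_def
    by (rule pred_pre_measurable[of "\<lambda>\<sigma>. n < length (\<phi> \<sigma>) \<and> \<phi> \<sigma> ! n"])
qed

text \<open>The preimage of a cylinder is decided by computably many bits. The image is therefore
  computable for every computable \<kappa>, even one that charges points where T is
  undefined.\<close>

lemma pushforward_total_map:
  assumes \<kappa>: "computable_measure \<kappa>"
  shows "computable_measure (distr \<kappa> cantor (total_map k))"
    and "emeasure (distr \<kappa> cantor (total_map k)) (cyl \<sigma>) = emeasure \<kappa> (total_map k -` cyl \<sigma>)"
proof -
  have M: "sets \<kappa> = sets cantor" "finite_measure \<kappa>" using \<kappa> by (auto simp: computable_measure_def)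
  have m: "total_map k \<in> measurable \<kappa> cantor"
    using total_map_measurable measurable_cong_sets[OF M(1) refl] by blast
  have sp: "space \<kappa> = UNIV" using sets_eq_imp_space_eq[OF M(1)] by simp
  show e: "emeasure (distr \<kappa> cantor (total_map k)) (cyl \<sigma>) = emeasure \<kappa> (total_map k -` cyl \<sigma>)" for \<sigma>
    by (subst emeasure_distr[OF m]) (simp_all add: sp)
  show "computable_measure (distr \<kappa> cantor (total_map k))"
  proof (rule computable_measureI)
    show "finite_measure (distr \<kappa> cantor (total_map k))"
      by (rule finite_measure.finite_measure_distr[OF M(2) m])
    have "computable_reals (\<lambda>c. measure \<kappa> {X. \<forall>i<code_len c. total_map k X i = code_bit c i})"
    proof (rule computable_reals_event[OF \<kappa>])
      fix c X Z assume "pre X (\<Sum>i<code_len c. s (i + k)) = pre Z (\<Sum>i<code_len c. s (i + k))"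
      from total_map_cong[OF this]
      show "(\<forall>i<code_len c. total_map k X i = code_bit c i) = (\<forall>i<code_len c. total_map k Z i = code_bit c i)"
        by (auto simp: pre_eq_iff)
    next
      have t: "total_map k X n = code_bit (bl_code (out X (s (n + k)))) n" for X n
        by (simp add: total_map_def code_bit_bl_code)
      show "computable (\<lambda>z. of_bool (\<forall>i<code_len (pfst z). total_map k (bit (psnd z)) i = code_bit (pfst z) i))"
        unfolding t by (intro cintro computable_out computable_comp[OF s])
      show "computable (\<lambda>c. \<Sum>i<code_len c. s (i + k))"
        by (intro cintro computable_comp[OF s])
    qed
    moreover have "total_map k -` cyl (bl_decode c) = {X. \<forall>i<code_len c. total_map k X i = code_bit c i}" for c
      by (auto simp: bl_decode_eq_pre mem_cyl_iff pre_eq_iff)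
    ultimately show "computable_reals (\<lambda>c. measure (distr \<kappa> cantor (total_map k)) (cyl (bl_decode c)))"
      by (simp add: measure_def e)
  qed simp
qed

lemma suminf_quarter_powers: "(\<Sum>n. ennreal (1 / 4 ^ (n + m))) = ennreal (4 / 3 * (1 / 4 ^ m))"
proof -
  have "(\<lambda>n. (1 / 4) ^ n * (1 / 4) ^ m) sums (1 / (1 - 1 / 4) * (1 / 4) ^ m :: real)"
    by (intro sums_mult2 geometric_sums) simp
  then have "(\<lambda>n. 1 / 4 ^ (n + m)) sums (4 / 3 * (1 / 4 ^ m) :: real)"
    by (simp add: power_one_over power_add)
  then show ?thesis by (rule suminf_ennreal_eq[rotated]) simp
qed

text \<open>Preimages under \<open>S\<close> are not clopen, so the integral over one of them is
  approximated by a locally constant integrand: the first A weights are kept, and membership is read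
  off the output at stage \<open>s M\<close>. The bounds on the integrals control the omitted
  weights; the pointwise bounds control the kept ones on \<open>late M\<close>, where the reading
  may be wrong. Both u and the constant weight 1 have this form.\<close>

lemma pushforward_weighted:
  fixes w :: "nat \<Rightarrow> (nat \<Rightarrow> bool) \<Rightarrow> nat"
  assumes r: "computable r" and w_cong: "\<And>n X Z. pre X (r n) = pre Z (r n) \<Longrightarrow> w n X = w n Z"
    and w: "computable (\<lambda>z. w (pfst z) (bit (psnd z)))"
    and w_le: "\<And>n X. w n X \<le> Suc n" and w_int: "\<And>n. (\<integral>\<^sup>+X. of_nat (w n X) \<partial>\<mu>) \<le> ennreal (1 / 4 ^ n)"
  shows "\<exists>U. computable_measure U \<and> (\<forall>\<sigma>. emeasure U (cyl \<sigma>)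
    = (\<integral>\<^sup>+X. (\<Sum>n. of_nat (w n X)) * indicator (S -` cyl \<sigma>) X \<partial>\<mu>))"
proof -
  have wm: "(\<lambda>X. (of_nat (w n X) :: ennreal)) \<in> borel_measurable \<mu>" for n
  proof -
    define g where "g \<sigma> = (of_nat (w n (\<lambda>i. if i < r n then \<sigma> ! i else False)) :: ennreal)" for \<sigma>
    have "of_nat (w n X) = g (pre X (r n))" for X
      unfolding g_def by (intro arg_cong[where f = of_nat] w_cong) (simp add: pre_eq_iff)
    then show ?thesis unfolding measurable_cong_sets[OF sets_\<mu> refl] by (simp only: fun_pre_measurable)
  qed
  define W where "W X = (\<Sum>n. of_nat (w n X) :: ennreal)" for X
  have Wm: "W \<in> borel_measurable \<mu>" unfolding W_def by (intro borel_measurable_suminf_order wm)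
  define F where "F \<sigma> = (\<integral>\<^sup>+X. W X * indicator (S -` cyl \<sigma>) X \<partial>\<mu>)" for \<sigma>
  have vs: "S -` cyl \<sigma> \<in> sets \<mu>" for \<sigma> using vimage_S_sets by (simp add: sets_\<mu>)
  have lm: "late n \<in> sets \<mu>" for n by (simp add: sets_\<mu> late_sets)
  have tail: "(\<integral>\<^sup>+X. (\<Sum>n. of_nat (w (n + A) X)) \<partial>\<mu>) \<le> ennreal (4 / 3 * (1 / 4 ^ A))" for A
  proof -
    have "(\<integral>\<^sup>+X. (\<Sum>n. of_nat (w (n + A) X)) \<partial>\<mu>) = (\<Sum>n. \<integral>\<^sup>+X. of_nat (w (n + A) X) \<partial>\<mu>)"
      by (rule nn_integral_suminf) (rule wm)
    also have "\<dots> \<le> (\<Sum>n. ennreal (1 / 4 ^ (n + A)))" by (intro suminf_le w_int) auto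
    finally show ?thesis by (simp only: suminf_quarter_powers)
  qed
  have F_le: "F \<sigma> \<le> ennreal (4 / 3)" for \<sigma>
  proof -
    have "F \<sigma> \<le> (\<integral>\<^sup>+X. W X \<partial>\<mu>)" unfolding F_def
      by (rule nn_integral_mono) (simp add: indicator_def)
    also have "\<dots> \<le> ennreal (4 / 3)" using tail[of 0] by (simp add: W_def)
    finally show ?thesis .
  qed
  let ?\<nu> = "density \<mu> W"
  have Sm: "S \<in> measurable ?\<nu> cantor"
    using S_measurable measurable_cong_sets[of ?\<nu> cantor cantor cantor] by (simp add: sets_\<mu>)
  let ?U = "distr ?\<nu> cantor S"
  have sp: "space \<mu> = UNIV" using sets_eq_imp_space_eq[OF sets_\<mu>] by simp
  have U: "emeasure ?U (cyl \<sigma>) = F \<sigma>" for \<sigma>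
    unfolding F_def by (subst emeasure_distr[OF Sm]) (simp_all add: sp emeasure_density[OF Wm vs])
  have "finite_measure ?U"
  proof (rule finite_measureI)
    show "emeasure ?U (space ?U) \<noteq> \<infinity>" using U[of "[]"] F_le[of "[]"] by (auto simp: top_unique)
  qed
  \<comment> \<open>The two errors are at most 4/3 * 4^-A and 4^A * 8^-M. As M is at least 2 A, the
    latter is at most 16^-A, and A = N + 2 brings the sum below 2^-N. Adding the length of the
    string to M makes the output long enough for the comparison off \<open>late M\<close>.\<close>
  define A where "A N = N + 2" for N :: nat
  define M where "M c N = code_len c + 2 * A N" for c N
  define match where "match c N X \<longleftrightarrow> code_len c \<le> length (out X (s (M c N)))
    \<and> (\<forall>i<code_len c. code_bit (bl_code (out X (s (M c N)))) i = code_bit c i)" for c N X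
  have match: "match c N X \<longleftrightarrow> S X \<in> cyl (bl_decode c)" if "X \<notin> late (M c N)" for c N X
  proof -
    have l: "code_len c < length (out X (s (M c N)))" using that by (simp add: late_def M_def)
    then have "code_bit (bl_code (out X (s (M c N)))) i = S X i" if "i < code_len c" for i
      using that S_eq_nth[of i X "s (M c N)"] by (simp add: code_bit_bl_code)
    then show ?thesis
      using l by (simp add: match_def bl_decode_eq_pre mem_cyl_iff pre_eq_iff)
  qed
  define D where "D c N X = (\<Sum>n<A N. w n X) * of_bool (match c N X)" for c N X
  define G where "G c N = (\<integral>\<^sup>+X. of_nat (D c N X) \<partial>\<mu>)" for c N
  \<comment> \<open>One function bounds the error in both directions: the omitted weights
    everywhere, and a bound for all kept weights where the reading is unreliable.\<close>
  define err where "err c N X = (\<Sum>n. of_nat (w (n + A N) X)) + ennreal (4 ^ A N) * indicator (late (M c N)) X" for c N X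
  have head: "(\<Sum>n<A N. of_nat (w n X)) \<le> ennreal (4 ^ A N)" for N X
  proof -
    have "(\<Sum>n<m. w n X) \<le> 4 ^ m" for m
    proof (induction m)
      case (Suc m)
      have "w m X \<le> 2 ^ m" using w_le[of m X] less_exp[of m] by linarith
      also have "\<dots> \<le> 4 ^ m" by (rule power_mono) auto
      finally show ?case using Suc by simp
    qed simp
    then have "of_nat (\<Sum>n<A N. w n X) \<le> (of_nat (4 ^ A N) :: ennreal)" by (rule of_nat_mono)
    then show ?thesis by (simp add: ennreal_power[symmetric])
  qed
  have W_eq: "W X = (\<Sum>n. of_nat (w (n + A N) X)) + (\<Sum>n<A N. of_nat (w n X))" for N X
    unfolding W_def by (rule suminf_offset) simp
  have D1: "W X * indicator (S -` cyl (bl_decode c)) X \<le> of_nat (D c N X) + err c N X" for c N X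
  proof (cases "X \<in> late (M c N)")
    case True
    have "W X * indicator (S -` cyl (bl_decode c)) X \<le> W X" by (simp add: indicator_def)
    also have "\<dots> \<le> err c N X" unfolding W_eq[of X N] err_def using True head by (simp add: add_left_mono)
    finally show ?thesis by (simp add: add_increasing)
  next
    case False
    show ?thesis
      using False by (simp add: W_eq[of X N] err_def D_def match[OF False] indicator_def add.commute)
  qed
  have D2: "of_nat (D c N X) \<le> W X * indicator (S -` cyl (bl_decode c)) X + err c N X" for c N X
  proof (cases "X \<in> late (M c N)")
    case True
    have "of_nat (D c N X) \<le> (\<Sum>n<A N. of_nat (w n X) :: ennreal)" by (simp add: D_def)
    also have "\<dots> \<le> ennreal (4 ^ A N)" by (rule head)
    also have "\<dots> \<le> err c N X" using True by (simp add: err_def add_increasing)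
    finally show ?thesis by (simp add: add_increasing)
  next
    case False
    show ?thesis
      using False by (simp add: W_eq[of X N] err_def D_def match[OF False] indicator_def)
  qed
  have Wim: "(\<lambda>X. W X * indicator (S -` cyl \<sigma>) X) \<in> borel_measurable \<mu>" for \<sigma>
    by (intro borel_measurable_times_ennreal Wm borel_measurable_indicator vs)
  have em: "err c N \<in> borel_measurable \<mu>" for c N
    unfolding err_def by (intro borel_measurable_add borel_measurable_times_ennreal borel_measurable_const
      borel_measurable_suminf_order wm borel_measurable_indicator lm)
  have err: "(\<integral>\<^sup>+X. err c N X \<partial>\<mu>) \<le> ennreal (1 / 2 ^ N)" for c N
  proof -
    have "(\<integral>\<^sup>+X. err c N X \<partial>\<mu>) = (\<integral>\<^sup>+X. (\<Sum>n. of_nat (w (n + A N) X)) \<partial>\<mu>) + ennreal (4 ^ A N) * emeasure \<mu> (late (M c N))"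
      unfolding err_def nn_integral_cmult_indicator[OF lm, symmetric]
      by (rule nn_integral_add) (intro borel_measurable_suminf_order wm borel_measurable_times_ennreal
          borel_measurable_const borel_measurable_indicator lm)+
    also have "\<dots> \<le> ennreal (4 / 3 * (1 / 4 ^ A N)) + ennreal (4 ^ A N) * ennreal (1 / 8 ^ M c N)"
      by (intro add_mono tail mult_left_mono emeasure_late) simp
    also have "\<dots> = ennreal (4 / 3 * (1 / 4 ^ A N) + 4 ^ A N * (1 / 8 ^ M c N))"
      by (simp add: ennreal_plus[symmetric] ennreal_mult[symmetric] del: ennreal_plus)
    also have "\<dots> \<le> ennreal (1 / 2 ^ N)"
    proof (rule ennreal_leI)
      have "4 ^ A N * (1 / 8 ^ M c N) \<le> (4 ^ A N * (1 / 8 ^ (2 * A N)) :: real)"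
        by (intro mult_left_mono divide_left_mono power_increasing) (auto simp: M_def)
      also have "\<dots> = (1 / 16) ^ A N" by (simp add: power_mult power_divide[symmetric] power_mult_distrib[symmetric])
      also have "\<dots> \<le> (1 / 4) ^ A N" by (rule power_mono) auto
      finally have "4 / 3 * (1 / 4) ^ A N + 4 ^ A N * (1 / 8 ^ M c N) \<le> 4 / 3 * (1 / 4) ^ A N + (1 / 4 :: real) ^ A N"
        by (rule add_left_mono)
      also have "\<dots> = 7 / 3 * (1 / 4) ^ A N" by (simp add: field_simps)
      also have "\<dots> \<le> 4 * (1 / 4) ^ A N" by (intro mult_right_mono) auto
      also have "\<dots> \<le> (1 / 4) ^ N" by (simp add: A_def)
      also have "\<dots> \<le> (1 / 2) ^ N" by (rule power_mono) auto
      finally show "4 / 3 * (1 / 4 ^ A N) + 4 ^ A N * (1 / 8 ^ M c N) \<le> (1 / 2 ^ N :: real)"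
        by (simp add: power_one_over)
    qed
    finally show ?thesis .
  qed
  define l where "l c N = (\<Sum>n<A N. r n) + s (M c N)" for c N
  have D_cong: "D c N X = D c N Z" if "pre X (l c N) = pre Z (l c N)" for c N X Z
  proof -
    have "w n X = w n Z" if "n < A N" for n
    proof (rule w_cong, rule pre_eq_mono)
      show "pre X (l c N) = pre Z (l c N)" by fact
      have "r n \<le> (\<Sum>n<A N. r n)" using that by (intro member_le_sum) auto
      then show "r n \<le> l c N" by (simp add: l_def)
    qed
    moreover have "out X (s (M c N)) = out Z (s (M c N))"
      by (rule out_cong, rule pre_eq_mono[OF that]) (simp add: l_def)
    ultimately show ?thesis by (simp add: D_def match_def)
  qed
  have G: "computable_reals (\<lambda>z. enn2real (G (pfst z) (psnd z)))"
    unfolding G_def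
  proof (rule computable_reals_integral[OF \<mu>])
    show "pre X (l (pfst z) (psnd z)) = pre Z (l (pfst z) (psnd z)) \<Longrightarrow> D (pfst z) (psnd z) X = D (pfst z) (psnd z) Z" for z X Z
      by (rule D_cong)
    show "computable (\<lambda>z. l (pfst z) (psnd z))"
      unfolding l_def A_def M_def by (intro cintro computable_comp[OF r] computable_comp[OF s])
    have w': "computable (\<lambda>x. w (g x) (bit (h x)))" if "computable g" "computable h" for g h
      using computable_comp[OF w, of "\<lambda>x. pair (g x) (h x)"] that by (simp add: cintro)
    have m: "code_len c \<le> length (out X m) \<longleftrightarrow> code_len c \<le> code_len (bl_code (out X m))" for c X m by simp
    show "computable (\<lambda>z. D (pfst (pfst z)) (psnd (pfst z)) (bit (psnd z)))"
      unfolding D_def match_def m A_def M_def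
      by (intro cintro w' computable_out computable_comp[OF s])
  qed
  have Gm: "(\<lambda>X. (of_nat (D c N X) :: ennreal)) \<in> borel_measurable \<mu>" for c N
  proof -
    define g where "g \<sigma> = (of_nat (D c N (\<lambda>i. if i < l c N then \<sigma> ! i else False)) :: ennreal)" for \<sigma>
    have "of_nat (D c N X) = g (pre X (l c N))" for X
      unfolding g_def by (intro arg_cong[where f = of_nat] D_cong) (simp add: pre_eq_iff)
    then show ?thesis unfolding measurable_cong_sets[OF sets_\<mu> refl] by (simp only: fun_pre_measurable)
  qed
  have close: "\<bar>enn2real (F (bl_decode c)) - enn2real (G c N)\<bar> \<le> 1 / 2 ^ N" for c N
  proof -
    have "F (bl_decode c) \<le> G c N + (\<integral>\<^sup>+X. err c N X \<partial>\<mu>)"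
      unfolding F_def G_def nn_integral_add[OF Gm em, symmetric] by (rule nn_integral_mono) (rule D1)
    also have "\<dots> \<le> G c N + ennreal (1 / 2 ^ N)" by (intro add_left_mono err)
    finally have 1: "F (bl_decode c) \<le> G c N + ennreal (1 / 2 ^ N)" .
    have "G c N \<le> F (bl_decode c) + (\<integral>\<^sup>+X. err c N X \<partial>\<mu>)"
      unfolding F_def G_def nn_integral_add[OF Wim em, symmetric] by (rule nn_integral_mono) (rule D2)
    also have "\<dots> \<le> F (bl_decode c) + ennreal (1 / 2 ^ N)" by (intro add_left_mono err)
    finally have 2: "G c N \<le> F (bl_decode c) + ennreal (1 / 2 ^ N)" .
    obtain x where x: "F (bl_decode c) = ennreal x" "0 \<le> x"
      using F_le[of "bl_decode c"] by (cases "F (bl_decode c)") (auto simp: top_unique)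
    obtain y where y: "G c N = ennreal y" "0 \<le> y"
      using 2 by (cases "G c N") (auto simp: x top_unique ennreal_plus[symmetric] simp del: ennreal_plus)
    have "x \<le> y + 1 / 2 ^ N" "y \<le> x + 1 / 2 ^ N"
      using 1 2 x(2) y(2) by (simp_all add: x(1) y(1) ennreal_plus[symmetric] del: ennreal_plus)
    then show ?thesis using x y by (simp add: abs_le_iff)
  qed
  have "computable_measure ?U"
  proof (rule computable_measureI)
    have "computable_reals (\<lambda>c. enn2real (F (bl_decode c)))"
      by (rule computable_reals_limit[OF G close])
    then show "computable_reals (\<lambda>c. measure ?U (cyl (bl_decode c)))" by (simp add: measure_def U)
  qed (simp, fact)
  then show ?thesis using U unfolding F_def W_def by blast
qed

end

subsection \<open>Lower semicontinuity\<close>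

text \<open>Openness of the sets where t exceeds c. Passing to the limit point uses nothing else
  about the tests, so the enumeration behind a lower semicomputable function is forgotten
  here.\<close>

definition lower_semicont :: "((nat \<Rightarrow> bool) \<Rightarrow> ennreal) \<Rightarrow> bool" where
  "lower_semicont t \<longleftrightarrow> (\<forall>X c. c < t X \<longrightarrow> (\<exists>m. \<forall>Z. pre Z m = pre X m \<longrightarrow> c < t Z))"

lemma lower_semicontD: "lower_semicont t \<Longrightarrow> c < t X \<Longrightarrow> \<exists>m. \<forall>Z. pre Z m = pre X m \<longrightarrow> c < t Z"
  by (simp add: lower_semicont_def)

text \<open>A value above B at X would persist on a whole cylinder around X, and that cylinder
  contains some \<open>x n\<close>.\<close>

lemma lower_semicont_limit:
  assumes "lower_semicont t" "\<And>m. infinite {n. pre (x n) m = pre X m}" "\<And>n. t (x n) \<le> B"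
  shows "t X \<le> B"
proof (rule ccontr)
  assume "\<not> t X \<le> B"
  then obtain m where m: "\<And>Z. pre Z m = pre X m \<Longrightarrow> B < t Z"
    using lower_semicontD[OF assms(1), of B X] by (auto simp: not_le)
  obtain n where "pre (x n) m = pre X m" using not_finite_existsD[OF assms(2)[of m]] by blast
  from m[OF this] assms(3)[of n] show False by simp
qed

lemma lower_semicomputable_imp_cont:
  assumes "lower_semicomputable t" shows "lower_semicont t"
  unfolding lower_semicont_def
proof (intro allI impI)
  fix X c assume c: "c < t X"
  obtain f :: "nat \<Rightarrow> nat" where f: "\<And>X. t X = (SUP n. (case prod_decode (f n) of (s, r) \<Rightarrow>
              (if X \<in> cyl (bl_decode s) then ennreal (rat_decode r) else 0)))"
    using assms unfolding lower_semicomputable_def by blast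
  from c obtain n where n: "c < (case prod_decode (f n) of (s, r) \<Rightarrow>
              (if X \<in> cyl (bl_decode s) then ennreal (rat_decode r) else 0))"
    unfolding f[of X] less_SUP_iff by blast
  obtain s r where sr: "prod_decode (f n) = (s, r)" by (cases "prod_decode (f n)")
  have X: "X \<in> cyl (bl_decode s)" "c < ennreal (rat_decode r)" using n by (auto simp: sr split: if_splits)
  show "\<exists>m. \<forall>Z. pre Z m = pre X m \<longrightarrow> c < t Z"
  proof (intro exI allI impI)
    fix Z assume "pre Z (length (bl_decode s)) = pre X (length (bl_decode s))"
    then have "Z \<in> cyl (bl_decode s)" using X(1) by (simp add: mem_cyl_iff)
    then have "c < (case prod_decode (f n) of (s, r) \<Rightarrow>
              (if Z \<in> cyl (bl_decode s) then ennreal (rat_decode r) else 0))" using X(2) by (simp add: sr)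
    then show "c < t Z" unfolding f[of Z] less_SUP_iff by blast
  qed
qed

lemma lower_semicont_measurable:
  assumes "lower_semicont t" shows "t \<in> borel_measurable cantor"
proof (rule borel_measurableI_greater)
  fix c
  define P where "P \<sigma> \<longleftrightarrow> (\<forall>Z. pre Z (length \<sigma>) = \<sigma> \<longrightarrow> c < t Z)" for \<sigma>
  have "{X \<in> space cantor. c < t X} = (\<Union>m. {X. P (pre X m)})"
    using lower_semicontD[OF assms, of c] by (auto simp: P_def)
  also have "\<dots> \<in> sets cantor"
    using pred_pre_measurable[of P] by (intro sets.countable_UN) (auto simp: pred_def)
  finally show "{X \<in> space cantor. c < t X} \<in> sets cantor" .
qed

text \<open>The bound by \<kappa> is given on cylinders; a set decided by the first l bits is a
  finite disjoint union of cylinders of length l, so it inherits the bound.\<close>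

lemma clopen_integral_le:
  assumes M: "sets M = sets cantor" "sets \<kappa> = sets cantor" and t: "t \<in> borel_measurable cantor"
    and le: "\<And>\<sigma>. set_nn_integral M (cyl \<sigma>) t \<le> emeasure \<kappa> (cyl \<sigma>)"
    and A: "A \<in> sets cantor" "\<And>X Z. pre X l = pre Z l \<Longrightarrow> X \<in> A \<longleftrightarrow> Z \<in> A"
  shows "set_nn_integral M A t \<le> emeasure \<kappa> A"
proof -
  have i: "indicator A X * indicator (cyl (pre (bit i) l)) X
    = (if bit i \<in> A then indicator (cyl (pre (bit i) l)) X else 0 :: ennreal)" for X and i :: nat
    using A(2)[of X "bit i"] by (auto simp: indicator_def mem_cyl_pre)
  have "set_nn_integral M A t = (\<Sum>i<2 ^ l. \<integral>\<^sup>+X\<in>cyl (pre (bit (i::nat)) l). t X * indicator A X \<partial>M)"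
    by (rule nn_integral_sum_cyl[OF M(1)])
      (use t A(1) in \<open>simp add: measurable_cong_sets[OF M(1) refl]\<close>)
  also have "\<dots> \<le> (\<Sum>i<2 ^ l. \<integral>\<^sup>+X\<in>cyl (pre (bit (i::nat)) l). indicator A X \<partial>\<kappa>)"
  proof (rule sum_mono)
    fix i :: nat
    show "(\<integral>\<^sup>+X\<in>cyl (pre (bit i) l). t X * indicator A X \<partial>M) \<le> (\<integral>\<^sup>+X\<in>cyl (pre (bit i) l). indicator A X \<partial>\<kappa>)"
      unfolding mult.assoc i using le[of "pre (bit i) l"] by (cases "bit i \<in> A") (simp_all add: M(2))
  qed
  also have "\<dots> = (\<integral>\<^sup>+X. indicator A X \<partial>\<kappa>)"
    by (rule nn_integral_sum_cyl[OF M(2), symmetric])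
      (use A(1) in \<open>simp add: measurable_cong_sets[OF M(2) refl]\<close>)
  finally show ?thesis using A(1) by (simp add: M(2))
qed

subsection \<open>Random preimages\<close>

context staged_map
begin

lemma late_cong:
  assumes "pre X (\<Sum>i<n. s i) = pre Z (\<Sum>i<n. s i)" "i < n"
  shows "X \<in> late i \<longleftrightarrow> Z \<in> late i"
proof -
  have "s i \<le> (\<Sum>i<n. s i)" using assms(2) by (intro member_le_sum) auto
  from out_cong[OF pre_eq_mono[OF assms(1) this]] show ?thesis by (simp add: late_def)
qed

text \<open>The function u. The factor n makes it infinite at every point that is late infinitely
  often, while its mean stays finite.\<close>

definition delay :: "(nat \<Rightarrow> bool) \<Rightarrow> ennreal" where
  "delay X = (\<Sum>n. of_nat (n * of_bool (X \<in> late n)))"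

lemma le_delay: "X \<in> late n \<Longrightarrow> of_nat n \<le> delay X"
  using sum_le_suminf[of "\<lambda>n. of_nat (n * of_bool (X \<in> late n)) :: ennreal" "{n}"] by (simp add: delay_def)

lemma delay_finite: "delay X \<noteq> \<infinity> \<Longrightarrow> \<exists>k. \<forall>i\<ge>k. X \<notin> late i"
proof (rule ccontr)
  assume "\<nexists>k. \<forall>i\<ge>k. X \<notin> late i" and fin: "delay X \<noteq> \<infinity>"
  then have "of_nat k \<le> delay X" for k
    using le_delay[of X] by (meson of_nat_mono order_trans)
  then have "(SUP k. of_nat k) \<le> delay X" by (intro SUP_least)
  then show False using fin by (simp add: ennreal_SUP_of_nat_eq_top top_unique)
qed

text \<open>Each partial sum depends on finitely many bits, and a supremum of locally constant
  functions is lower semicontinuous.\<close>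

lemma lower_semicont_delay: "lower_semicont delay"
  unfolding lower_semicont_def
proof (intro allI impI)
  fix X c assume "c < delay X"
  then obtain n where n: "c < (\<Sum>i<n. of_nat (i * of_bool (X \<in> late i)))"
    by (auto simp: delay_def suminf_eq_SUP less_SUP_iff)
  show "\<exists>m. \<forall>Z. pre Z m = pre X m \<longrightarrow> c < delay Z"
  proof (intro exI allI impI)
    fix Z assume Z: "pre Z (\<Sum>i<n. s i) = pre X (\<Sum>i<n. s i)"
    have "(\<Sum>i<n. of_nat (i * of_bool (X \<in> late i))) = (\<Sum>i<n. of_nat (i * of_bool (Z \<in> late i)) :: ennreal)"
      using late_cong[OF Z] by (intro sum.cong) auto
    with n show "c < delay Z" unfolding delay_def suminf_eq_SUP less_SUP_iff by auto
  qed
qed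

lemma delay_pushforward:
  "\<exists>U. computable_measure U \<and> (\<forall>\<sigma>. emeasure U (cyl \<sigma>) = (\<integral>\<^sup>+X. delay X * indicator (S -` cyl \<sigma>) X \<partial>\<mu>))"
  unfolding delay_def
proof (rule pushforward_weighted)
  show "computable s" by (rule s)
  show "n * of_bool (X \<in> late n) = n * of_bool (Z \<in> late n)" if "pre X (s n) = pre Z (s n)" for n X Z
    using out_cong[OF that] by (simp add: late_def)
  show "computable (\<lambda>z. pfst z * of_bool (bit (psnd z) \<in> late (pfst z)))"
    unfolding late_def mem_Collect_eq by (intro cintro computable_short computable_comp[OF s])
  show "n * of_bool (X \<in> late n) \<le> Suc n" for n X by simp
  show "(\<integral>\<^sup>+X. of_nat (n * of_bool (X \<in> late n)) \<partial>\<mu>) \<le> ennreal (1 / 4 ^ n)" for n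
  proof -
    have "(\<integral>\<^sup>+X. of_nat (n * of_bool (X \<in> late n)) \<partial>\<mu>) = (\<integral>\<^sup>+X. of_nat n * indicator (late n) X \<partial>\<mu>)"
      by (rule nn_integral_cong) (simp add: indicator_def)
    also have "\<dots> = of_nat n * emeasure \<mu> (late n)"
      by (rule nn_integral_cmult_indicator) (simp add: sets_\<mu> late_sets)
    also have "\<dots> \<le> of_nat n * ennreal (1 / 8 ^ n)" by (intro mult_left_mono emeasure_late) simp
    also have "\<dots> = ennreal (real n * (1 / 8 ^ n))" unfolding ennreal_of_nat_eq_real_of_nat
      by (rule ennreal_mult[symmetric]) simp_all
    also have "\<dots> \<le> ennreal (1 / 4 ^ n)"
    proof (rule ennreal_leI)
      have "real n * (1 / 8 ^ n) \<le> 2 ^ n * (1 / 8 ^ n)" by (intro mult_right_mono nat_le_power_2) simp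
      also have "\<dots> = 2 ^ n * (1 / (2 ^ n * 4 ^ n))" by (simp flip: power_mult_distrib)
      also have "\<dots> = 1 / 4 ^ n" by simp
      finally show "real n * (1 / 8 ^ n) \<le> 1 / 4 ^ n" .
    qed
    finally show ?thesis .
  qed
qed

lemma pushforward_cyl: "emeasure (pushforward \<mu> T) (cyl \<sigma>) = emeasure \<mu> (S -` cyl \<sigma>)"
proof -
  let ?g = "\<lambda>X. case T X of Some Y \<Rightarrow> Y | None \<Rightarrow> (\<lambda>_. False)"
  have g: "?g = (\<lambda>X. if X \<in> dom then S X else (\<lambda>_. False))" by (auto simp: T_eq fun_eq_iff)
  have gm: "?g \<in> measurable \<mu> cantor"
    unfolding measurable_cong_sets[OF sets_\<mu> refl] g
    by (intro measurable_If_set S_measurable measurable_const) (simp_all add: dom_sets)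
  have sp: "space \<mu> = UNIV" using sets_eq_imp_space_eq[OF sets_\<mu>] by simp
  have "emeasure (pushforward \<mu> T) (cyl \<sigma>) = emeasure \<mu> (?g -` cyl \<sigma>)"
    unfolding pushforward_def by (subst emeasure_distr[OF gm]) (simp_all add: sp)
  also have "\<dots> = emeasure \<mu> (S -` cyl \<sigma>)"
  proof (rule emeasure_eq_AE)
    show "AE X in \<mu>. (X \<in> ?g -` cyl \<sigma>) = (X \<in> S -` cyl \<sigma>)"
      using AE_dom by eventually_elim (simp add: T_eq)
    show "?g -` cyl \<sigma> \<in> sets \<mu>" using measurable_sets[OF gm cyl_measurable] by (simp add: sp)
    show "S -` cyl \<sigma> \<in> sets \<mu>" using vimage_S_sets by (simp add: sets_\<mu>)
  qed
  finally show ?thesis .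
qed

text \<open>The case of weight 1, obtained from the weights \<open>of_bool (n = 0)\<close>, which
  sum to 1.\<close>

lemma computable_pushforward: "computable_measure (pushforward \<mu> T)"
proof -
  have "\<exists>U. computable_measure U \<and> (\<forall>\<sigma>. emeasure U (cyl \<sigma>)
    = (\<integral>\<^sup>+X. (\<Sum>n. of_nat (of_bool (n = 0))) * indicator (S -` cyl \<sigma>) X \<partial>\<mu>))"
  proof (rule pushforward_weighted)
    show "computable (\<lambda>n. 0)" by (rule computable_const)
    show "computable (\<lambda>z. of_bool (pfst z = 0))" by (intro cintro)
    show "(\<integral>\<^sup>+X. of_nat (of_bool (n = 0)) \<partial>\<mu>) \<le> ennreal (1 / 4 ^ n)" for n :: nat
      by (cases n) (simp_all add: emeasure_space_1)
  qed auto
  moreover have "(\<Sum>n. of_nat (of_bool (n = (0::nat)))) = (1 :: ennreal)"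
    by (subst suminf_finite[of "{0}"]) auto
  ultimately obtain U where U: "computable_measure U" "\<And>\<sigma>. emeasure U (cyl \<sigma>) = emeasure \<mu> (S -` cyl \<sigma>)"
    using vimage_S_sets by (auto simp: sets_\<mu>)
  have m: "measure (pushforward \<mu> T) (cyl \<sigma>) = measure U (cyl \<sigma>)" for \<sigma>
    by (simp add: measure_def U pushforward_cyl)
  have "finite_measure (pushforward \<mu> T)"
  proof (rule finite_measureI)
    show "emeasure (pushforward \<mu> T) (space (pushforward \<mu> T)) \<noteq> \<infinity>"
      using pushforward_cyl[of "[]"] by (simp add: pushforward_def)
  qed
  moreover have "sets (pushforward \<mu> T) = sets cantor" by (simp add: pushforward_def)
  ultimately show ?thesis
    using U(1) by (simp add: computable_measure_def m)
qed

text \<open>At a point never late from k on, this is the supremum of min(n, t), that is t itself. If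
  i \<ge> k is a late index, only n \<le> i contribute, so the value is at most i and hence at most
  u. The conditions on X are clopen, which preserves lower semicontinuity.\<close>

definition capped :: "nat \<Rightarrow> ((nat \<Rightarrow> bool) \<Rightarrow> ennreal) \<Rightarrow> (nat \<Rightarrow> bool) \<Rightarrow> ennreal" where
  "capped k t X = (SUP n. if \<forall>i<n. k \<le> i \<longrightarrow> X \<notin> late i then min (of_nat n) (t X) else 0)"

lemma lower_semicont_capped:
  assumes "lower_semicont t" shows "lower_semicont (capped k t)"
  unfolding lower_semicont_def
proof (intro allI impI)
  fix X c assume "c < capped k t X"
  then obtain n where n: "c < (if \<forall>i<n. k \<le> i \<longrightarrow> X \<notin> late i then min (of_nat n) (t X) else 0)"
    unfolding capped_def less_SUP_iff by blast
  then have X: "\<forall>i<n. k \<le> i \<longrightarrow> X \<notin> late i" "c < of_nat n" "c < t X" by (auto split: if_splits)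
  obtain m where m: "\<And>Z. pre Z m = pre X m \<Longrightarrow> c < t Z" using lower_semicontD[OF assms X(3)] by blast
  let ?l = "m + (\<Sum>i<n. s i)"
  show "\<exists>m. \<forall>Z. pre Z m = pre X m \<longrightarrow> c < capped k t Z"
  proof (intro exI allI impI)
    fix Z assume Z: "pre Z ?l = pre X ?l"
    have "c < t Z" by (rule m, rule pre_eq_mono[OF Z]) simp
    moreover have "\<forall>i<n. k \<le> i \<longrightarrow> Z \<notin> late i"
      using late_cong[OF pre_eq_mono[OF Z], of n] X(1) by simp
    ultimately have "c < (if \<forall>i<n. k \<le> i \<longrightarrow> Z \<notin> late i then min (of_nat n) (t Z) else 0)"
      using X(2) by simp
    then show "c < capped k t Z" unfolding capped_def less_SUP_iff by blast
  qed
qed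

lemma capped_top:
  assumes "\<And>i. k \<le> i \<Longrightarrow> X \<notin> late i" "t X = \<infinity>" shows "capped k t X = \<infinity>"
  using assms by (simp add: capped_def ennreal_SUP_of_nat_eq_top)

text \<open>The two summands use different preimages on purpose: where X is never late from k on,
  \<open>total_map k\<close> and \<open>S\<close> agree at X, so the clopen preimage may replace the
  other; elsewhere u already bounds the left side, and the preimage under \<open>S\<close> is
  kept.\<close>

lemma capped_le:
  "capped k t X * indicator (S -` A) X \<le> t X * indicator (total_map k -` A) X + delay X * indicator (S -` A) X"
proof (cases "\<forall>i\<ge>k. X \<notin> late i")
  case True
  then have "total_map k X = S X" by (intro total_map_eq) auto
  moreover have "capped k t X \<le> t X" unfolding capped_def by (rule SUP_least) auto
  ultimately show ?thesis by (auto simp: indicator_def add_increasing2)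
next
  case False
  then obtain i where i: "k \<le> i" "X \<in> late i" by auto
  have "capped k t X \<le> delay X"
    unfolding capped_def
  proof (rule SUP_least)
    fix n
    show "(if \<forall>i<n. k \<le> i \<longrightarrow> X \<notin> late i then min (of_nat n) (t X) else 0) \<le> delay X"
    proof (cases "\<forall>i<n. k \<le> i \<longrightarrow> X \<notin> late i")
      case True
      then have "n \<le> i" using i by (meson not_le)
      then have "of_nat n \<le> delay X" using le_delay[OF i(2)] by (meson of_nat_mono order_trans)
      then show ?thesis by (auto simp: min.coboundedI1)
    qed auto
  qed
  then show ?thesis by (auto simp: indicator_def add_increasing)
qed

text \<open>The integral splits into the image of \<kappa> under the total map and the image of u
  \<mu> under \<open>S\<close>. Each is a computable measure and is compared with \<nu> separately,
  so the constants add.\<close>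

lemma capped_bounded:
  assumes t: "lower_semicomputable t" and \<kappa>: "computable_measure \<kappa>"
    and le: "\<And>\<sigma>. set_nn_integral \<mu> (cyl \<sigma>) t \<le> emeasure \<kappa> (cyl \<sigma>)"
    and Y: "computably_random (pushforward \<mu> T) Y"
  shows "\<exists>C>0. \<forall>n. (\<integral>\<^sup>+X. capped k t X * indicator (S -` cyl (pre Y n)) X \<partial>\<mu>)
    \<le> ennreal C * emeasure \<mu> (S -` cyl (pre Y n))"
proof -
  obtain U where U: "computable_measure U"
      "\<And>\<sigma>. emeasure U (cyl \<sigma>) = (\<integral>\<^sup>+X. delay X * indicator (S -` cyl \<sigma>) X \<partial>\<mu>)"
    using delay_pushforward by blast
  note K = pushforward_total_map[OF \<kappa>, of k]
  note bounded = computably_random_ratio_bounded[OF computable_pushforward _ Y]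
  obtain C where C: "C > 0" "\<And>n. measure (distr \<kappa> cantor (total_map k)) (cyl (pre Y n)) + 1 / 2 ^ n
      \<le> C * measure (pushforward \<mu> T) (cyl (pre Y n))"
    using bounded[OF K(1)] by blast
  obtain D where D: "D > 0" "\<And>n. measure U (cyl (pre Y n)) + 1 / 2 ^ n \<le> D * measure (pushforward \<mu> T) (cyl (pre Y n))"
    using bounded[OF U(1)] by blast
  have M: "sets \<kappa> = sets cantor" using \<kappa> by (simp add: computable_measure_def)
  have tm: "t \<in> borel_measurable cantor"
    by (rule lower_semicont_measurable[OF lower_semicomputable_imp_cont[OF t]])
  have dm: "delay \<in> borel_measurable cantor"
    by (rule lower_semicont_measurable[OF lower_semicont_delay])
  have ts: "total_map k -` cyl \<sigma> \<in> sets cantor" for \<sigma>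
    using measurable_sets[OF total_map_measurable cyl_measurable] by simp
  \<comment> \<open>Here e stands for the term 1 / 2^n, which is dropped.\<close>
  have bound: "emeasure M' (cyl \<sigma>) \<le> ennreal c * emeasure \<mu> (S -` cyl \<sigma>)"
    if "computable_measure M'" "0 < c" "measure M' (cyl \<sigma>) + e \<le> c * measure (pushforward \<mu> T) (cyl \<sigma>)" "0 \<le> e"
    for M' c e \<sigma>
  proof -
    interpret M': finite_measure M' using that(1) by (simp add: computable_measure_def)
    interpret P: finite_measure "pushforward \<mu> T" using computable_pushforward by (simp add: computable_measure_def)
    have "emeasure M' (cyl \<sigma>) \<le> ennreal (c * measure (pushforward \<mu> T) (cyl \<sigma>))"
      unfolding M'.emeasure_eq_measure using that(3,4) by (intro ennreal_leI) simp
    also have "\<dots> = ennreal c * emeasure \<mu> (S -` cyl \<sigma>)"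
      using that(2) by (simp add: ennreal_mult P.emeasure_eq_measure flip: pushforward_cyl)
    finally show ?thesis .
  qed
  show ?thesis
  proof (intro exI[of _ "C + D"] conjI allI)
    show "0 < C + D" using C(1) D(1) by simp
    fix n
    define \<sigma> where "\<sigma> = pre Y n"
    have "(\<integral>\<^sup>+X. capped k t X * indicator (S -` cyl \<sigma>) X \<partial>\<mu>)
      \<le> (\<integral>\<^sup>+X. t X * indicator (total_map k -` cyl \<sigma>) X + delay X * indicator (S -` cyl \<sigma>) X \<partial>\<mu>)"
      by (rule nn_integral_mono) (rule capped_le)
    also have "\<dots> = set_nn_integral \<mu> (total_map k -` cyl \<sigma>) t + emeasure U (cyl \<sigma>)"
      unfolding U(2)
      by (rule nn_integral_add; unfold measurable_cong_sets[OF sets_\<mu> refl];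
          intro borel_measurable_times_ennreal borel_measurable_indicator tm dm ts vimage_S_sets)
    also have "set_nn_integral \<mu> (total_map k -` cyl \<sigma>) t \<le> emeasure \<kappa> (total_map k -` cyl \<sigma>)"
    proof (rule clopen_integral_le[OF sets_\<mu> M tm le ts])
      show "X \<in> total_map k -` cyl \<sigma> \<longleftrightarrow> Z \<in> total_map k -` cyl \<sigma>"
        if "pre X (\<Sum>i<length \<sigma>. s (i + k)) = pre Z (\<Sum>i<length \<sigma>. s (i + k))" for X Z
        using total_map_cong[OF that] by (simp add: mem_cyl_iff)
    qed
    also have "\<dots> \<le> ennreal C * emeasure \<mu> (S -` cyl \<sigma>)"
      unfolding K(2)[symmetric] using C(2)[of n] by (intro bound K C(1)) (auto simp: \<sigma>_def)
    also have "emeasure U (cyl \<sigma>) \<le> ennreal D * emeasure \<mu> (S -` cyl \<sigma>)"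
      using D(2)[of n] by (intro bound U D(1)) (auto simp: \<sigma>_def)
    also have "ennreal C * emeasure \<mu> (S -` cyl \<sigma>) + ennreal D * emeasure \<mu> (S -` cyl \<sigma>)
      = ennreal (C + D) * emeasure \<mu> (S -` cyl \<sigma>)"
      using C(1) D(1) by (simp add: distrib_right)
    finally show "(\<integral>\<^sup>+X. capped k t X * indicator (S -` cyl (pre Y n)) X \<partial>\<mu>)
      \<le> ennreal (C + D) * emeasure \<mu> (S -` cyl (pre Y n))"
      by (simp add: \<sigma>_def add_mono)
  qed
qed

text \<open>Positivity of the preimages comes from the summand 1 / 2^n in the ratio bound; without
  it a mean value bound on them would not yield any point.\<close>

lemma delay_bounded:
  assumes Y: "computably_random (pushforward \<mu> T) Y"
  shows "\<exists>C>0. \<forall>n. (\<integral>\<^sup>+X. delay X * indicator (S -` cyl (pre Y n)) X \<partial>\<mu>)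
    \<le> ennreal C * emeasure \<mu> (S -` cyl (pre Y n)) \<and> 0 < emeasure \<mu> (S -` cyl (pre Y n))"
proof -
  obtain U where U: "computable_measure U"
      "\<And>\<sigma>. emeasure U (cyl \<sigma>) = (\<integral>\<^sup>+X. delay X * indicator (S -` cyl \<sigma>) X \<partial>\<mu>)"
    using delay_pushforward by blast
  obtain D where D: "D > 0" "\<And>n. measure U (cyl (pre Y n)) + 1 / 2 ^ n \<le> D * measure (pushforward \<mu> T) (cyl (pre Y n))"
    using computably_random_ratio_bounded[OF computable_pushforward U(1) Y] by blast
  interpret U: finite_measure U using U(1) by (simp add: computable_measure_def)
  interpret P: finite_measure "pushforward \<mu> T" using computable_pushforward by (simp add: computable_measure_def)
  show ?thesis
  proof (intro exI[of _ D] conjI allI D(1))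
    fix n
    let ?\<sigma> = "pre Y n"
    have "emeasure U (cyl ?\<sigma>) \<le> ennreal (D * measure (pushforward \<mu> T) (cyl ?\<sigma>))"
      unfolding U.emeasure_eq_measure using D(2)[of n] order_trans[OF _ D(2)[of n]] by (intro ennreal_leI) simp
    also have "\<dots> = ennreal D * emeasure \<mu> (S -` cyl ?\<sigma>)"
      using D(1) by (simp add: ennreal_mult P.emeasure_eq_measure flip: pushforward_cyl)
    finally show "(\<integral>\<^sup>+X. delay X * indicator (S -` cyl ?\<sigma>) X \<partial>\<mu>) \<le> ennreal D * emeasure \<mu> (S -` cyl ?\<sigma>)"
      by (simp add: U(2))
    have "0 < 1 / (2::real) ^ n" by simp
    also have "\<dots> \<le> measure U (cyl ?\<sigma>) + 1 / 2 ^ n" by simp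
    also have "\<dots> \<le> D * measure (pushforward \<mu> T) (cyl ?\<sigma>)" by (rule D(2))
    finally have "0 < measure (pushforward \<mu> T) (cyl ?\<sigma>)" using D(1) by (simp add: zero_less_mult_iff)
    then show "0 < emeasure \<mu> (S -` cyl ?\<sigma>)" by (simp add: P.emeasure_eq_measure flip: pushforward_cyl)
  qed
qed

end

section \<open>Choice of the preimage\<close>

lemma countable_lower_semicomputable: "countable {t. lower_semicomputable t}"
proof (rule countable_subset)
  let ?t = "\<lambda>f :: nat \<Rightarrow> nat. \<lambda>X. (SUP n. (case prod_decode (f n) of (s, r) \<Rightarrow>
              (if X \<in> cyl (bl_decode s) then ennreal (rat_decode r) else 0)))"
  show "{t. lower_semicomputable t} \<subseteq> ?t ` {f. computable f}"
  proof
    fix t :: "(nat \<Rightarrow> bool) \<Rightarrow> ennreal" assume "t \<in> {t. lower_semicomputable t}"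
    then obtain f :: "nat \<Rightarrow> nat" where "computable f" "\<forall>X. t X = ?t f X"
      unfolding lower_semicomputable_def mem_Collect_eq by blast
    then show "t \<in> ?t ` {f. computable f}" by (intro image_eqI[of _ _ f]) (auto simp: fun_eq_iff)
  qed
  show "countable (?t ` {f. computable f})" by (intro countable_image countable_computable)
qed

text \<open>Makes the class of tests non-empty, so that it can be enumerated by a sequence.\<close>

lemma lower_semicomputable_0: "lower_semicomputable (\<lambda>_. 0)"
  unfolding lower_semicomputable_def
proof (intro exI[of _ "\<lambda>_. 0"] conjI allI)
  have "prod_decode 0 = (0, 0)" using prod_encode_inverse[of "(0, 0)"] by (simp add: prod_encode_def)
  then show "0 = (SUP n::nat. (case prod_decode 0 of (s, r) \<Rightarrow>
              (if X \<in> cyl (bl_decode s) then ennreal (rat_decode r) else 0)))" for X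
    by (simp add: rat_decode_def)
qed simp

context staged_map
begin

lemma random_preimage:
  assumes Y: "computably_random (pushforward \<mu> T) Y"
  shows "\<exists>X. computably_random \<mu> X \<and> T X = Some Y"
proof -
  define tests where "tests = {t. lower_semicomputable t \<and> (\<exists>\<kappa>. computable_measure \<kappa> \<and>
     (\<forall>\<sigma>. set_nn_integral \<mu> (cyl \<sigma>) t \<le> emeasure \<kappa> (cyl \<sigma>)))}"
  have "countable tests"
    by (rule countable_subset[OF _ countable_lower_semicomputable]) (auto simp: tests_def)
  then have "countable (tests \<times> (UNIV :: nat set))" by simp
  moreover have "(\<lambda>_. 0) \<in> tests" using lower_semicomputable_0 \<mu> by (auto simp: tests_def)
  then have "tests \<times> (UNIV :: nat set) \<noteq> {}" by auto
  \<comment> \<open>Tests are enumerated together with all k, because the index from which the limit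
    point is never late is known only afterwards.\<close>
  ultimately obtain g :: "nat \<Rightarrow> _" where g: "range g = tests \<times> (UNIV :: nat set)"
    by (metis range_from_nat_into)
  define c where "c j = capped (snd (g j)) (fst (g j))" for j
  have gt: "fst (g j) \<in> tests" for j using g by (metis mem_Times_iff rangeI)
  have c_cont: "lower_semicont (c j)" for j
    unfolding c_def using gt[of j] by (intro lower_semicont_capped lower_semicomputable_imp_cont) (simp add: tests_def)
  let ?A = "\<lambda>n. S -` cyl (pre Y n)"
  have "\<exists>C>0. \<forall>n. (\<integral>\<^sup>+X. c j X * indicator (?A n) X \<partial>\<mu>) \<le> ennreal C * emeasure \<mu> (?A n)" for j
    using gt[of j] unfolding c_def tests_def by (blast intro: capped_bounded[OF _ _ _ Y])
  then obtain C where C: "\<And>j. C j > 0"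
    "\<And>j n. (\<integral>\<^sup>+X. c j X * indicator (?A n) X \<partial>\<mu>) \<le> ennreal (C j) * emeasure \<mu> (?A n)"
    by metis
  obtain D where D: "D > 0" "\<And>n. (\<integral>\<^sup>+X. delay X * indicator (?A n) X \<partial>\<mu>) \<le> ennreal D * emeasure \<mu> (?A n)"
    "\<And>n. 0 < emeasure \<mu> (?A n)"
    using delay_bounded[OF Y] by blast
  \<comment> \<open>Division by the constant of the j-th test makes its share of the mean at most
    2^-(j + 1), so all tests together add 1 to the bound D for u.\<close>
  define a where "a j = ennreal ((1 / 2) ^ Suc j / C j)" for j
  define G where "G X = delay X + (\<Sum>j. a j * c j X)" for X
  have dm: "delay \<in> borel_measurable \<mu>" unfolding measurable_cong_sets[OF sets_\<mu> refl]
    by (rule lower_semicont_measurable[OF lower_semicont_delay])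
  have cm: "c j \<in> borel_measurable \<mu>" for j unfolding measurable_cong_sets[OF sets_\<mu> refl]
    by (rule lower_semicont_measurable[OF c_cont])
  have As: "?A n \<in> sets \<mu>" for n using vimage_S_sets by (simp add: sets_\<mu>)
  have G_int: "(\<integral>\<^sup>+X. G X * indicator (?A n) X \<partial>\<mu>) \<le> ennreal (D + 1) * emeasure \<mu> (?A n)" for n
  proof -
    have "(\<integral>\<^sup>+X. G X * indicator (?A n) X \<partial>\<mu>)
      = (\<integral>\<^sup>+X. delay X * indicator (?A n) X + (\<Sum>j. a j * (c j X * indicator (?A n) X)) \<partial>\<mu>)"
      unfolding G_def by (rule nn_integral_cong) (simp add: indicator_def)
    also have "\<dots> = (\<integral>\<^sup>+X. delay X * indicator (?A n) X \<partial>\<mu>)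
        + (\<integral>\<^sup>+X. (\<Sum>j. a j * (c j X * indicator (?A n) X)) \<partial>\<mu>)"
      by (rule nn_integral_add; intro borel_measurable_suminf_order borel_measurable_times_ennreal
          borel_measurable_const borel_measurable_indicator dm cm As)
    also have "(\<integral>\<^sup>+X. (\<Sum>j. a j * (c j X * indicator (?A n) X)) \<partial>\<mu>)
      = (\<Sum>j. \<integral>\<^sup>+X. a j * (c j X * indicator (?A n) X) \<partial>\<mu>)"
      by (rule nn_integral_suminf) (intro borel_measurable_times_ennreal
          borel_measurable_const borel_measurable_indicator cm As)
    also have "\<dots> = (\<Sum>j. a j * (\<integral>\<^sup>+X. c j X * indicator (?A n) X \<partial>\<mu>))"
      by (intro suminf_cong nn_integral_cmult borel_measurable_times_ennreal borel_measurable_indicator cm As)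
    also have "\<dots> \<le> (\<Sum>j. ennreal ((1 / 2) ^ Suc j) * emeasure \<mu> (?A n))"
    proof (rule suminf_le)
      fix j
      have "a j * (\<integral>\<^sup>+X. c j X * indicator (?A n) X \<partial>\<mu>) \<le> a j * (ennreal (C j) * emeasure \<mu> (?A n))"
        by (intro mult_left_mono C) simp
      also have "\<dots> = ennreal ((1 / 2) ^ Suc j / C j * C j) * emeasure \<mu> (?A n)"
        unfolding a_def using C(1)[of j] by (subst ennreal_mult) (auto simp: mult.assoc)
      also have "(1 / 2) ^ Suc j / C j * C j = (1 / 2) ^ Suc j" using C(1)[of j] by simp
      finally show "a j * (\<integral>\<^sup>+X. c j X * indicator (?A n) X \<partial>\<mu>) \<le> ennreal ((1 / 2) ^ Suc j) * emeasure \<mu> (?A n)" .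
    qed auto
    also have "\<dots> = ennreal 1 * emeasure \<mu> (?A n)"
      unfolding ennreal_suminf_multc by (subst suminf_ennreal_eq[OF _ power_half_series]) auto
    also have "(\<integral>\<^sup>+X. delay X * indicator (?A n) X \<partial>\<mu>) \<le> ennreal D * emeasure \<mu> (?A n)" by (rule D(2))
    also have "ennreal D * emeasure \<mu> (?A n) + ennreal 1 * emeasure \<mu> (?A n) = ennreal (D + 1) * emeasure \<mu> (?A n)"
      using D(1) by (simp add: distrib_right)
    finally show ?thesis by (simp add: add_mono)
  qed
  \<comment> \<open>Any value strictly above the mean bound D + 1 would do: if G exceeded it on the
    whole preimage, which has positive measure, the mean would be too large.\<close>
  define B where "B = ennreal (D + 2)"
  have "\<exists>X. S X \<in> cyl (pre Y n) \<and> G X \<le> B" for n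
  proof (rule ccontr)
    assume "\<nexists>X. S X \<in> cyl (pre Y n) \<and> G X \<le> B"
    then have "B \<le> G X" if "X \<in> ?A n" for X using that by (auto simp: not_le intro: less_imp_le)
    then have "(\<integral>\<^sup>+X. B * indicator (?A n) X \<partial>\<mu>) \<le> (\<integral>\<^sup>+X. G X * indicator (?A n) X \<partial>\<mu>)"
      by (intro nn_integral_mono) (auto simp: indicator_def)
    also have "\<dots> \<le> ennreal (D + 1) * emeasure \<mu> (?A n)" by (rule G_int)
    finally have "ennreal ((D + 2) * measure \<mu> (?A n)) \<le> ennreal ((D + 1) * measure \<mu> (?A n))"
      using D(1) by (simp add: B_def nn_integral_cmult_indicator[OF As] emeasure_eq_measure ennreal_mult[symmetric] del: ennreal_plus)
    then have "(D + 2) * measure \<mu> (?A n) \<le> (D + 1) * measure \<mu> (?A n)"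
      using D(1) by (subst (asm) ennreal_le_iff) auto
    moreover have "0 < measure \<mu> (?A n)" using D(3)[of n] by (simp add: emeasure_eq_measure)
    ultimately show False by simp
  qed
  then obtain x where x: "\<And>n. S (x n) \<in> cyl (pre Y n)" "\<And>n. G (x n) \<le> B" by metis
  \<comment> \<open>Preimages of cylinders under \<open>S\<close> are not closed, so compactness
    gives a limit in the whole space only; that its image is Y must still be derived from the
    finiteness of u.\<close>
  obtain X where X: "\<And>m. infinite {n. pre (x n) m = pre X m}" using cantor_limit_point[of x] by blast
  have "delay (x n) \<le> B" for n
  proof -
    have "delay (x n) \<le> G (x n)" by (simp add: G_def)
    with x(2)[of n] show ?thesis by (rule order_trans[rotated])
  qed
  from lower_semicont_limit[OF lower_semicont_delay X this] have "delay X \<noteq> \<infinity>"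
    by (auto simp: B_def top_unique)
  then obtain k where k: "\<And>i. k \<le> i \<Longrightarrow> X \<notin> late i" using delay_finite by blast
  have dom: "X \<in> dom" by (rule total_map_eq(2)[OF k])
  have "S X i = Y i" for i
  proof -
    let ?m = "s (i + k)"
    have l: "i < length (out X ?m)" using k[of "i + k"] by (simp add: late_def)
    \<comment> \<open>At stage \<open>s (i + k)\<close> bit i of the output at X is already present.
      A point \<open>x n\<close> sharing that prefix outputs the same bit, and for n > i this bit is
      the one of Y.\<close>
    obtain n where n: "i < n" "pre (x n) ?m = pre X ?m"
      using X[of ?m] by (auto simp: infinite_nat_iff_unbounded)
    have "S (x n) i = S X i"
      using l out_cong[OF n(2)] by (simp add: S_eq_nth[of i _ ?m])
    moreover have "S (x n) i = Y i" using x(1)[of n] n(1) by (auto simp: mem_cyl_pre pre_eq_iff)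
    ultimately show ?thesis by simp
  qed
  then have "T X = Some Y" using dom by (auto simp: T_eq)
  moreover have "computably_random \<mu> X"
    unfolding computably_random_def
  proof (intro allI impI)
    fix t \<kappa>
    assume "lower_semicomputable t" "computable_measure \<kappa>"
      "\<forall>\<sigma>. set_nn_integral \<mu> (cyl \<sigma>) t \<le> emeasure \<kappa> (cyl \<sigma>)"
    then have "(t, k) \<in> range g" unfolding g tests_def by blast
    then obtain j where j: "g j = (t, k)" by (metis rangeE)
    have a: "a j \<noteq> 0" "a j \<noteq> \<top>" using C(1)[of j] by (simp_all add: a_def)
    \<comment> \<open>The bound on G is divided by the positive weight of one test; semicontinuity
      is then applied to that test alone, so nothing has to be known about G itself at X.\<close>
    have "c j (x n) \<le> B / a j" for n
    proof -
      have "c j (x n) * a j \<le> (\<Sum>j. a j * c j (x n))"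
        using sum_le_suminf[of "\<lambda>j. a j * c j (x n)" "{j}"] by (simp add: mult.commute[of "c j (x n)"])
      also have "\<dots> \<le> G (x n)" by (simp add: G_def)
      also have "\<dots> \<le> B" by (rule x(2))
      finally have "c j (x n) * a j / a j \<le> B / a j" by (rule divide_right_mono_ennreal)
      then show ?thesis by (simp only: ennreal_mult_divide_eq[OF a])
    qed
    from lower_semicont_limit[OF c_cont X this] have "c j X \<le> B / a j" .
    also have "\<dots> < \<infinity>" using a by (auto simp: B_def ennreal_divide_eq_top_iff simp flip: less_top)
    finally have "capped k t X \<noteq> \<infinity>" by (simp add: c_def j)
    then have "t X \<noteq> \<infinity>" using capped_top[of k X t] k by blast
    then show "t X < \<infinity>" by (simp add: less_top)
  qed
  ultimately show ?thesis by blast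
qed

end

theorem mainTheorem9:
  fixes \<mu> :: "(nat \<Rightarrow> bool) measure"
    and T :: "(nat \<Rightarrow> bool) \<Rightarrow> (nat \<Rightarrow> bool) option"
    and Y :: "nat \<Rightarrow> bool"
  assumes "computable_measure \<mu>" and "prob_space \<mu>"
    and "ae_computable \<mu> T"
    and "computably_random (pushforward \<mu> T) Y"
  shows "\<exists>X. computably_random \<mu> X \<and> T X = Some Y"
proof -
  obtain \<phi> f where f: "computable f" "\<And>\<sigma>. f (bl_code \<sigma>) = bl_code (\<phi> \<sigma>)"
     "\<And>\<sigma> \<tau>. prefix \<sigma> \<tau> \<Longrightarrow> prefix (\<phi> \<sigma>) (\<phi> \<tau>)"
     "\<And>X Y. T X = Some Y \<longleftrightarrow> (\<forall>n. \<exists>m. prefix (pre Y n) (\<phi> (pre X m)))"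
    using assms(3) unfolding ae_computable_def partial_computable_def by blast
  interpret computable_map \<mu> T \<phi> f
    using assms(1,2,3) f by (intro computable_map.intro) (auto simp: ae_computable_def)
  obtain s where "computable s" "\<And>n. measure \<mu> {X. length (out X (s n)) \<le> n} \<le> 1 / 8 ^ n"
    using stages_exist by blast
  then interpret staged_map \<mu> T \<phi> f s by unfold_locales
  show ?thesis using assms(4) by (rule random_preimage)
qed

end
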